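(* Let $k = k(n)$ be integers with $k \asymp n$ and $k \le n$ (i.e. there is a constant $c>0$ with $cn \le k \le n$). Let $A$ be chosen uniformly at random among all $k$-element subsets of $\{1,\dots,n\}$, and let $A/A = \{a/a' : a,a' \in A\}$. Then, with probability $1-o(1)$ as $n \to \infty$, $|A/A| \sim \mu_2(k/n) n^2$; that is, for every $\varepsilon>0$, $$\lim_{n\to\infty}\mathbb{P}\left(\left|\frac{|A/A|}{\mu_2(k/n)n^2}-1\right|>\varepsilon\right)=0,$$ where for $\alpha \in (0,1)$, $\mu_2(\alpha) = \frac{\alpha^2}{\zeta(2)}\frac{\operatorname{Li}_2(1-\alpha^2)}{1-\alpha^2}$, and $\mu_2(1) = 1/\zeta(2) = 6/\pi^2$ (the limit of $\mu_2(\alpha)$ as $\alpha \to 1$).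
   Context: $\operatorname{Li}_2(z)=\sum_{k\ge1} z^k/k^2$ is the dilogarithm; $\zeta(2)=\pi^2/6$. *)

theory Defs
  imports "HOL-Probability.Probability"
begin

text \<open>The series is indexed from \<open>k = j + 1\<close>; it converges for \<open>norm z \<le> 1\<close>.\<close>
definition dilog :: "'a \<Rightarrow> 'a::{real_normed_field,banach}" where
  "dilog z = (\<Sum>j. z ^ Suc j / of_nat (Suc j) ^ 2)"

definition zeta2 :: real where
  "zeta2 = (\<Sum>j. 1 / real (Suc j) ^ 2)"

lemma zeta2_eq: "zeta2 = pi\<^sup>2 / 6"
  using inverse_squares_sums by (simp add: zeta2_def sums_iff add.commute)

text \<open>
  Only arguments in \<open>(0, 1]\<close> are meaningful. The value at \<open>1\<close> is the limit
  from the left, see \<open>mu2_tendsto\<close> below.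
\<close>
definition mu2 :: "real \<Rightarrow> real" where
  "mu2 \<alpha> =
    (if \<alpha> = 1 then 1 / zeta2
     else \<alpha>\<^sup>2 / zeta2 * (dilog (1 - \<alpha>\<^sup>2) / (1 - \<alpha>\<^sup>2)))"

lemma mu2_1: "mu2 1 = 6 / pi\<^sup>2"
  by (simp add: mu2_def zeta2_eq)

lemma mu2_tendsto: "(mu2 \<longlongrightarrow> mu2 1) (at_left 1)"
proof -
  define g :: "real \<Rightarrow> real" where "g = (\<lambda>z. \<Sum>j. 1 / real (Suc j) ^ 2 * z ^ j)"
  have summ: "summable (\<lambda>j. 1 / real (Suc j) ^ 2 * 1 ^ j)"
    using inverse_squares_sums by (simp add: sums_iff add.commute)
  have "isCont g 0"
    unfolding g_def by (rule isCont_powser[OF summ]) simp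
  moreover have "g 0 = 1"
    unfolding g_def by (subst suminf_finite[of "{0}"]) auto
  ultimately have g: "(g \<longlongrightarrow> 1) (at 0)"
    by (simp add: isCont_def)
  have lim: "filterlim (\<lambda>\<alpha>::real. 1 - \<alpha>\<^sup>2) (at 0) (at_left 1)"
  proof (rule filterlim_atI)
    have "((\<lambda>\<alpha>::real. 1 - \<alpha>\<^sup>2) \<longlongrightarrow> 1 - 1\<^sup>2) (at_left 1)"
      by (intro tendsto_intros)
    then show "((\<lambda>\<alpha>::real. 1 - \<alpha>\<^sup>2) \<longlongrightarrow> 0) (at_left 1)" by simp
    show "\<forall>\<^sub>F \<alpha> in at_left (1::real). 1 - \<alpha>\<^sup>2 \<noteq> 0"
      by (rule eventually_mono[OF eventually_at_left_real[OF zero_less_one]]) (auto simp: power2_eq_1_iff)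
  qed
  have dil: "dilog z / z = g z" if "z \<noteq> 0" "\<bar>z\<bar> < 1" for z :: real
  proof -
    have "summable (\<lambda>j. 1 / real (Suc j) ^ 2 * z ^ j)"
      by (rule powser_inside[OF summ]) (use that in simp)
    then have "z * g z = (\<Sum>j. z * (1 / real (Suc j) ^ 2 * z ^ j))"
      unfolding g_def by (rule suminf_mult[symmetric])
    also have "\<dots> = dilog z"
      unfolding dilog_def by (simp add: field_simps)
    finally show ?thesis using that by (simp add: field_simps)
  qed
  have "((\<lambda>\<alpha>. \<alpha>\<^sup>2 / zeta2 * g (1 - \<alpha>\<^sup>2)) \<longlongrightarrow> 1\<^sup>2 / zeta2 * 1) (at_left 1)"
    by (intro tendsto_intros filterlim_compose[OF g lim]) (simp add: zeta2_eq)
  moreover have "\<forall>\<^sub>F \<alpha> in at_left 1. \<alpha>\<^sup>2 / zeta2 * g (1 - \<alpha>\<^sup>2) = mu2 \<alpha>"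
  proof (rule eventually_mono[OF eventually_at_left_real[OF zero_less_one]])
    fix \<alpha> :: real
    assume "\<alpha> \<in> {0<..<1}"
    then have "0 < \<alpha>\<^sup>2" "\<alpha>\<^sup>2 < 1" by (auto simp: power_less_one_iff)
    with \<open>\<alpha> \<in> {0<..<1}\<close> show "\<alpha>\<^sup>2 / zeta2 * g (1 - \<alpha>\<^sup>2) = mu2 \<alpha>"
      by (simp add: mu2_def dil)
  qed
  ultimately have "(mu2 \<longlongrightarrow> 1\<^sup>2 / zeta2 * 1) (at_left 1)"
    by (simp add: filterlim_cong)
  then show ?thesis by (simp add: mu2_def)
qed

definition quotient_set :: "nat set \<Rightarrow> rat set" where
  "quotient_set A = {of_nat a / of_nat a' | a a'. a \<in> A \<and> a' \<in> A}"

definition random_subset :: "nat \<Rightarrow> nat \<Rightarrow> nat set pmf" where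
  "random_subset n k = pmf_of_set {A. A \<subseteq> {1..n} \<and> card A = k}"

end

theory Submission
  imports Defs "HOL-Real_Asymp.Real_Asymp"
begin

text \<open>
  The size of \<open>A/A\<close> is the number of coprime pairs \<open>(r, s)\<close> such that \<open>A\<close> contains
  \<open>{m r, m s}\<close> for some \<open>m \<le> n / max r s\<close>. Unless \<open>min r s\<close> or \<open>n / max r s\<close> is exceptional
  (few pairs are), these two-element sets are disjoint and there are boundedly many of them, so a
  random \<open>A\<close> of density \<open>\<alpha>\<close> avoids all of them with probability close to
  \<open>(1 - \<alpha>\<^sup>2) ^ (n div max r s)\<close>. Two typical coprime pairs are asymptotically independent for the
  same reason, and Chebyshev's inequality gives concentration. Writing
  \<open>1 - z ^ m = (\<Sum>j<m. (1 - z) * z ^ j)\<close> with \<open>z = 1 - \<alpha>\<^sup>2\<close>, the mean becomes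
  \<open>\<Sum>j. \<alpha>\<^sup>2 * z ^ j * F (n / (j + 1))\<close>, where \<open>F x \<sim> x\<^sup>2 / \<zeta>(2)\<close> counts the coprime pairs up to
  \<open>x\<close>; this is the series of \<open>mu2 \<alpha> * n\<^sup>2\<close>.

  The asymptotics of \<open>F\<close> needs no Moebius inversion: from \<open>\<Sum>d. F (x / d) = \<lfloor>x\<rfloor>\<^sup>2\<close> the relative
  error of \<open>F x\<close> is at most \<open>\<zeta>(2) - 1 \<le> 3 / 4\<close> times the error bound at smaller arguments, up to
  lower order terms, so the error bound contracts to \<open>0\<close>.
\<close>

subsection \<open>Counting coprime pairs\<close>

text \<open>Telescoping with 1/(N+1)^2 <= 1/N - 1/(N+1). Keeping \<open>m\<close> terms exact gives
  both the constant 3/4 below (\<open>m = 2\<close>) and small tails (large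
  \<open>m\<close>).\<close>

lemma sum_inverse_squares_le:
  assumes "1 \<le> m" "m \<le> N"
  shows "(\<Sum>d=1..N. 1 / real d ^ 2) \<le> (\<Sum>d=1..m. 1 / real d ^ 2) + 1 / real m - 1 / real N"
  using assms(2)
proof (induction N rule: dec_induct)
  case (step N)
  have "1 / real (Suc N) ^ 2 \<le> 1 / (real N * real (Suc N))"
    using step assms by (intro divide_left_mono) (auto simp: power2_eq_square)
  also have "\<dots> = 1 / real N - 1 / real (Suc N)"
    using step assms by (simp add: field_simps)
  finally show ?case using step by simp
qed simp

lemma zeta2_sums: "(\<lambda>j. 1 / real (Suc j) ^ 2) sums zeta2"
  using inverse_squares_sums by (simp add: zeta2_eq add.commute)

lemma sum_inverse_squares_Suc: "(\<Sum>j<N. 1 / real (Suc j) ^ 2) = (\<Sum>d=1..N. 1 / real d ^ 2)"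
  by (rule sum.reindex_bij_witness[of _ "\<lambda>d. d - 1" Suc]) auto

lemma sum_le_zeta2: "(\<Sum>d=1..N. 1 / real d ^ 2) \<le> zeta2"
proof -
  have "(\<Sum>j<N. 1 / real (Suc j) ^ 2) \<le> zeta2"
    unfolding zeta2_def by (rule sum_le_suminf) (use zeta2_sums in \<open>auto simp: sums_iff\<close>)
  then show ?thesis by (simp only: sum_inverse_squares_Suc)
qed

lemma zeta2_le_sum:
  assumes "1 \<le> m"
  shows "zeta2 \<le> (\<Sum>d=1..m. 1 / real d ^ 2) + 1 / real m"
proof (rule LIMSEQ_le_const2)
  show "(\<lambda>N. \<Sum>j<N. 1 / real (Suc j) ^ 2) \<longlonglongrightarrow> zeta2"
    using zeta2_sums by (simp add: sums_def)
  show "\<exists>N. \<forall>n\<ge>N. (\<Sum>j<n. 1 / real (Suc j) ^ 2) \<le> (\<Sum>d=1..m. 1 / real d ^ 2) + 1 / real m"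
  proof (intro exI allI impI)
    fix n assume "m \<le> n"
    have "(\<Sum>j<n. 1 / real (Suc j) ^ 2) = (\<Sum>d=1..n. 1 / real d ^ 2)"
      by (rule sum_inverse_squares_Suc)
    also have "\<dots> \<le> (\<Sum>d=1..m. 1 / real d ^ 2) + 1 / real m - 1 / real n"
      by (rule sum_inverse_squares_le) (use assms \<open>m \<le> n\<close> in auto)
    also have "\<dots> \<le> (\<Sum>d=1..m. 1 / real d ^ 2) + 1 / real m" by simp
    finally show "(\<Sum>j<n. 1 / real (Suc j) ^ 2) \<le> (\<Sum>d=1..m. 1 / real d ^ 2) + 1 / real m" .
  qed
qed

lemma zeta2_ge_1: "1 \<le> zeta2"
  using sum_le_zeta2[of 1] by simp

text \<open>The argument is real so that the dilations \<open>x / d\<close> and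
  \<open>n / (j + 1)\<close> need no rounding.\<close>

definition coprime_pairs :: "real \<Rightarrow> (nat \<times> nat) set" where
  "coprime_pairs x =
    {(r, s). 1 \<le> r \<and> 1 \<le> s \<and> real r \<le> x \<and> real s \<le> x \<and> coprime r s}"

definition coprime_error :: "real \<Rightarrow> real" where
  "coprime_error x = real (card (coprime_pairs x)) - x\<^sup>2 / zeta2"

lemma coprime_pairs_subset:
  "coprime_pairs x \<subseteq> {1..nat \<lfloor>x\<rfloor>} \<times> {1..nat \<lfloor>x\<rfloor>}"
  unfolding coprime_pairs_def by (auto simp: le_nat_floor)

lemma finite_coprime_pairs [simp]: "finite (coprime_pairs x)"
  by (rule finite_subset[OF coprime_pairs_subset]) auto

lemma coprime_pairs_mono: "x \<le> y \<Longrightarrow> coprime_pairs x \<subseteq> coprime_pairs y"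
  unfolding coprime_pairs_def by auto

lemma coprime_pairs_empty: "x < 1 \<Longrightarrow> coprime_pairs x = {}"
  using coprime_pairs_subset[of x] by (auto simp: nat_eq_iff)

lemma card_coprime_pairs_le:
  assumes "0 \<le> x"
  shows "real (card (coprime_pairs x)) \<le> x\<^sup>2"
proof -
  have "card (coprime_pairs x) \<le> nat \<lfloor>x\<rfloor> * nat \<lfloor>x\<rfloor>"
    using card_mono[OF _ coprime_pairs_subset[of x]] by simp
  then have "real (card (coprime_pairs x)) \<le> real (nat \<lfloor>x\<rfloor>) * real (nat \<lfloor>x\<rfloor>)"
    by (metis of_nat_le_iff of_nat_mult)
  also have "\<dots> \<le> x * x"
    using assms by (intro mult_mono) auto
  finally show ?thesis by (simp add: power2_eq_square)
qed

text \<open>Both the count and its main term lie between 0 and x^2. This crude bound starts the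
  iteration and handles large \<open>d\<close> in each of its steps.\<close>

lemma abs_coprime_error_le:
  assumes "0 \<le> x"
  shows "\<bar>coprime_error x\<bar> \<le> x\<^sup>2"
proof -
  have "x\<^sup>2 / zeta2 \<le> x\<^sup>2" "0 \<le> x\<^sup>2 / zeta2"
    using divide_left_mono[OF zeta2_ge_1, of "x\<^sup>2"] zeta2_ge_1 by auto
  then show ?thesis
    using card_coprime_pairs_le[OF assms] unfolding coprime_error_def by linarith
qed

text \<open>The pairs in a square are sorted by their gcd \<open>d\<close>; dividing by
  \<open>d\<close> leaves a coprime pair with entries at most \<open>x / d\<close>.\<close>

lemma sum_card_coprime_pairs:
  "(\<Sum>d=1..nat \<lfloor>x\<rfloor>. card (coprime_pairs (x / real d))) = (nat \<lfloor>x\<rfloor>)\<^sup>2"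
proof -
  let ?N = "nat \<lfloor>x\<rfloor>"
  let ?S = "SIGMA d:{1..?N}. coprime_pairs (x / real d)"
  have "bij_betw (\<lambda>(d, r, s). (d * r, d * s)) ?S ({1..?N} \<times> {1..?N})"
  proof (rule bij_betw_byWitness[where f' = "\<lambda>(a, b). (gcd a b, a div gcd a b, b div gcd a b)"])
    show "(\<lambda>(d, r, s). (d * r, d * s)) ` ?S \<subseteq> {1..?N} \<times> {1..?N}"
    proof (rule image_subsetI)
      fix p assume "p \<in> ?S"
      then obtain d r s where p: "p = (d, r, s)" "d \<in> {1..?N}" "(r, s) \<in> coprime_pairs (x / real d)"
        by auto
      then have "real (d * r) \<le> x" "real (d * s) \<le> x" "1 \<le> d * r" "1 \<le> d * s"
        by (auto simp: coprime_pairs_def field_simps)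
      then show "(\<lambda>(d, r, s). (d * r, d * s)) p \<in> {1..?N} \<times> {1..?N}"
        unfolding p(1) by (auto simp: le_nat_floor)
    qed
    show "(\<lambda>(a, b). (gcd a b, a div gcd a b, b div gcd a b)) ` ({1..?N} \<times> {1..?N}) \<subseteq> ?S"
    proof (rule image_subsetI)
      fix p assume "p \<in> {1..?N} \<times> {1..?N}"
      then obtain a b where p: "p = (a, b)" and ab: "a \<in> {1..?N}" "b \<in> {1..?N}" by auto
      define g where "g = gcd a b"
      obtain r s where rs: "a = g * r" "b = g * s" "coprime r s"
        using gcd_coprime_exists[of a b] ab unfolding g_def by (auto simp: mult.commute)
      have "1 \<le> ?N" using ab by simp
      then have "0 < x" by linarith
      then have "real a \<le> x" "real b \<le> x" using ab by (auto simp: le_nat_iff le_floor_iff)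
      moreover have "g \<ge> 1" "r \<ge> 1" "s \<ge> 1" using ab rs by (auto simp: Suc_le_eq intro: Nat.gr0I)
      moreover have "g \<le> a" using rs \<open>r \<ge> 1\<close> by simp
      ultimately have "(r, s) \<in> coprime_pairs (x / real g)"
        using rs by (auto simp: coprime_pairs_def field_simps)
      moreover have "g \<in> {1..?N}" using \<open>g \<ge> 1\<close> \<open>g \<le> a\<close> ab by simp
      ultimately show "(\<lambda>(a, b). (gcd a b, a div gcd a b, b div gcd a b)) p \<in> ?S"
        using rs \<open>g \<ge> 1\<close> unfolding p prod.case g_def[symmetric] by (auto simp: rs)
    qed
  qed (auto simp: coprime_pairs_def gcd_mult_distrib_nat[symmetric])
  then have "card ?S = card ({1..?N} \<times> {1..?N})" by (rule bij_betw_same_card)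
  then show ?thesis by (simp add: power2_eq_square)
qed

text \<open>Solving the gcd identity for its term \<open>d = 1\<close> expresses the error at
  \<open>x\<close> through the errors at \<open>x / d\<close> with d >= 2, and the sum of 1/d^2 over
  those \<open>d\<close> is at most 3/4. The constant \<open>B\<close> is charged only for
  \<open>d \<le> D\<close>; larger \<open>d\<close> get the trivial bound x^2/d^2.\<close>

lemma coprime_error_bound_step:
  assumes "0 < a" and B: "\<And>x. 0 \<le> x \<Longrightarrow> \<bar>coprime_error x\<bar> \<le> a * x\<^sup>2 + B"
  shows "\<exists>B'. \<forall>x\<ge>0. \<bar>coprime_error x\<bar> \<le> 7 / 8 * a * x\<^sup>2 + B'"
proof -
  have "0 \<le> B" using B[of 0] by (auto simp: coprime_error_def)
  \<comment> \<open>The budget is 7/8 = 3/4 + 1/16 + 1/16: one sixteenth pays for the tail x^2/D,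
    which dictates \<open>D > 16 / a\<close>, the other for the terms linear in
    \<open>x\<close>.\<close>
  obtain D :: nat where D: "real D > max 2 (16 / a)" using reals_Archimedean2 by blast
  then have "D \<ge> 2" by simp
  have aD: "1 / real D \<le> a / 16" using D \<open>0 < a\<close> by (simp add: field_simps)
  show ?thesis
  proof (intro exI allI impI)
    fix x :: real assume "0 \<le> x"
    \<comment> \<open>In the constant, 1 covers \<open>x < 1\<close>, \<open>D * B\<close> the small
      divisors, and \<open>64 / a\<close> the terms linear in \<open>x\<close>.\<close>
    show "\<bar>coprime_error x\<bar> \<le> 7 / 8 * a * x\<^sup>2 + (1 + D * B + 64 / a)"
    proof (cases "x < 1")
      case True
      then have "x\<^sup>2 \<le> 1" using \<open>0 \<le> x\<close> by (simp add: power_le_one)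
      then show ?thesis
        using abs_coprime_error_le[OF \<open>0 \<le> x\<close>] \<open>0 < a\<close> \<open>0 \<le> B\<close>
        by (smt (verit) divide_nonneg_nonneg mult_nonneg_nonneg of_nat_0_le_iff zero_le_power2)
    next
      case False
      define N where "N = nat \<lfloor>x\<rfloor>"
      have N: "1 \<le> N" "real N \<le> x" "x < real N + 1"
        using False unfolding N_def by (auto simp: le_nat_iff le_floor_iff)
      define t where "t = (\<Sum>d=1..N. 1 / real d ^ 2)"
      have "real N ^ 2 = (\<Sum>d=1..N. real (card (coprime_pairs (x / real d))))"
        using sum_card_coprime_pairs[of x] unfolding N_def[symmetric]
        by (metis of_nat_power of_nat_sum)
      also have "\<dots> = (\<Sum>d=1..N. coprime_error (x / real d) + x\<^sup>2 / zeta2 * (1 / real d ^ 2))"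
        by (intro sum.cong) (auto simp: coprime_error_def power_divide)
      also have "\<dots> = (\<Sum>d=1..N. coprime_error (x / real d)) + x\<^sup>2 / zeta2 * t"
        by (simp add: sum.distrib sum_distrib_left t_def)
      also have "(\<Sum>d=1..N. coprime_error (x / real d)) =
          coprime_error x + (\<Sum>d=2..N. coprime_error (x / real d))"
        using sum.atLeast_Suc_atMost[OF N(1), of "\<lambda>d. coprime_error (x / real d)"]
        by (simp add: numeral_2_eq_2)
      finally have eq: "coprime_error x =
          real N ^ 2 - x\<^sup>2 / zeta2 * t - (\<Sum>d=2..N. coprime_error (x / real d))" by simp
      have "x\<^sup>2 - 2 * x \<le> real N ^ 2" "real N ^ 2 \<le> x\<^sup>2"
      proof -
        have "(x - 1)\<^sup>2 \<le> real N ^ 2" using N False by (intro power_mono) auto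
        then show "x\<^sup>2 - 2 * x \<le> real N ^ 2" by (simp add: power2_eq_square algebra_simps)
        show "real N ^ 2 \<le> x\<^sup>2" using N by (intro power_mono) auto
      qed
      moreover have "x\<^sup>2 / zeta2 * t \<le> x\<^sup>2" "x\<^sup>2 - 2 * x \<le> x\<^sup>2 / zeta2 * t"
      proof -
        have "t \<le> zeta2" unfolding t_def by (rule sum_le_zeta2)
        then have "x\<^sup>2 * t \<le> x\<^sup>2 * zeta2" by (intro mult_left_mono) auto
        then show "x\<^sup>2 / zeta2 * t \<le> x\<^sup>2" using zeta2_ge_1 by (simp add: field_simps)
        \<comment> \<open>The tail of the zeta series beyond \<open>N\<close> is at most 1/N, which
          costs x^2/N <= 2x because x <= 2N.\<close>
        have "x\<^sup>2 / zeta2 * (zeta2 - t) \<le> x\<^sup>2 / 1 * (1 / N)"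
          using zeta2_le_sum[OF N(1)] \<open>t \<le> zeta2\<close> zeta2_ge_1 N unfolding t_def
          by (intro mult_mono divide_left_mono) auto
        also have "\<dots> \<le> 2 * x"
        proof -
          have "x * x \<le> x * (2 * N)" using N by (intro mult_left_mono) auto
          then show ?thesis using N by (simp add: field_simps power2_eq_square)
        qed
        finally show "x\<^sup>2 - 2 * x \<le> x\<^sup>2 / zeta2 * t" using zeta2_ge_1 by (simp add: field_simps)
      qed
      moreover have "\<bar>\<Sum>d=2..N. coprime_error (x / real d)\<bar> \<le>
          a * x\<^sup>2 * (3 / 4) + D * B + x\<^sup>2 * (1 / D)"
      proof -
        have "\<bar>coprime_error (x / real d)\<bar> \<le> a * x\<^sup>2 * (1 / real d ^ 2) +
            (if d \<le> D then B else 0) + x\<^sup>2 * (if D < d then 1 / real d ^ 2 else 0)" for d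
          using B[of "x / real d"] abs_coprime_error_le[of "x / real d"] \<open>0 \<le> x\<close> \<open>0 < a\<close>
          by (auto simp: power_divide intro: order_trans)
        then have "\<bar>\<Sum>d=2..N. coprime_error (x / real d)\<bar> \<le>
           (\<Sum>d=2..N. a * x\<^sup>2 * (1 / real d ^ 2) + (if d \<le> D then B else 0) +
              x\<^sup>2 * (if D < d then 1 / real d ^ 2 else 0))"
          by (intro order_trans[OF sum_abs] sum_mono)
        also have "\<dots> = a * x\<^sup>2 * (\<Sum>d=2..N. 1 / real d ^ 2) + (\<Sum>d=2..N. if d \<le> D then B else 0) +
            x\<^sup>2 * (\<Sum>d=2..N. if D < d then 1 / real d ^ 2 else 0)"
          by (simp only: sum.distrib sum_distrib_left)
        also have "\<dots> \<le> a * x\<^sup>2 * (3 / 4) + D * B + x\<^sup>2 * (1 / D)"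
        proof (intro add_mono mult_left_mono)
          show "(\<Sum>d=2..N. 1 / real d ^ 2) \<le> 3 / 4"
          proof (cases "N \<ge> 2")
            case True
            have "(\<Sum>d=1..N. 1 / real d ^ 2) \<le> (\<Sum>d=1..2. 1 / real d ^ 2) + 1 / real 2 - 1 / real N"
              by (rule sum_inverse_squares_le) (use True in auto)
            moreover have "(\<Sum>d=1..N. 1 / real d ^ 2) = 1 + (\<Sum>d=2..N. 1 / real d ^ 2)"
              using sum.atLeast_Suc_atMost[OF N(1), of "\<lambda>d. 1 / real d ^ 2"]
          by (simp add: numeral_2_eq_2)
            moreover have "(\<Sum>d=1..2. 1 / real d ^ 2) = 5 / 4"
              by (simp add: numeral_2_eq_2 power2_eq_square)
            moreover have "0 \<le> 1 / real N" by simp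
            ultimately show ?thesis by linarith
          qed auto
          have "(\<Sum>d=2..N. if d \<le> D then B else 0) = (\<Sum>d\<in>{2..N} \<inter> {..D}. B)"
            by (subst sum.inter_restrict) (auto intro!: sum.cong)
          also have "\<dots> = real (card ({2..N} \<inter> {..D})) * B" by simp
          also have "card ({2..N} \<inter> {..D}) \<le> card {1..D}" by (rule card_mono) auto
          then have "real (card ({2..N} \<inter> {..D})) * B \<le> D * B"
            using \<open>0 \<le> B\<close> by (intro mult_right_mono) auto
          finally show "(\<Sum>d=2..N. if d \<le> D then B else 0) \<le> D * B" .
          show "(\<Sum>d=2..N. if D < d then 1 / real d ^ 2 else 0) \<le> 1 / D"
          proof (cases "D \<le> N")
            case True
            have "(\<Sum>d=2..N. if D < d then 1 / real d ^ 2 else 0) = (\<Sum>d\<in>{D<..N}. 1 / real d ^ 2)"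
              using \<open>D \<ge> 2\<close> by (intro sum.mono_neutral_cong_right) auto
            also have "\<dots> = (\<Sum>d=1..N. 1 / real d ^ 2) - (\<Sum>d=1..D. 1 / real d ^ 2)"
            proof -
              have "{1..N} = {1..D} \<union> {D<..N}" using True \<open>D \<ge> 2\<close> by auto
              then have "(\<Sum>d=1..N. 1 / real d ^ 2) = (\<Sum>d\<in>{1..D} \<union> {D<..N}. 1 / real d ^ 2)"
                by (rule arg_cong)
              also have "\<dots> = (\<Sum>d=1..D. 1 / real d ^ 2) + (\<Sum>d\<in>{D<..N}. 1 / real d ^ 2)"
                by (rule sum.union_disjoint) auto
              finally show ?thesis by simp
            qed
            also have "\<dots> \<le> 1 / D - 1 / N"
              using sum_inverse_squares_le[of D N] True \<open>D \<ge> 2\<close> by simp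
            also have "\<dots> \<le> 1 / D" by simp
            finally show ?thesis .
          next
            case False
            then have "(\<Sum>d=2..N. if D < d then 1 / real d ^ 2 else 0) = 0"
              by (intro sum.neutral) auto
            then show ?thesis by simp
          qed
        qed (use \<open>0 < a\<close> in auto)
        finally show ?thesis .
      qed
      moreover have "x\<^sup>2 * (1 / D) \<le> x\<^sup>2 * (a / 16)" using aD by (rule mult_left_mono) simp
      moreover have "4 * x \<le> a / 16 * x\<^sup>2 + 64 / a"
      proof -
        \<comment> \<open>AM-GM\<close>
        have "0 \<le> (a * x / 4 - 8)\<^sup>2 / a" using \<open>0 < a\<close> by simp
        also have "\<dots> = a / 16 * x\<^sup>2 + 64 / a - 4 * x"
          using \<open>0 < a\<close> by (simp add: power2_eq_square field_simps)
        finally show ?thesis by simp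
      qed
      ultimately have "\<bar>coprime_error x\<bar> \<le>
          4 * x + (a * x\<^sup>2 * (3 / 4) + D * B + x\<^sup>2 * (a / 16))"
        unfolding eq using \<open>0 \<le> x\<close> by linarith
      then show ?thesis using \<open>4 * x \<le> a / 16 * x\<^sup>2 + 64 / a\<close> by (simp add: algebra_simps)
    qed
  qed
qed

text \<open>From the trivial bound with factor 1, each step gains a factor 7/8. An additive constant
  is allowed so that the bound holds for all x >= 0, as the arguments \<open>n / (j + 1)\<close> can
  be small.\<close>

lemma coprime_error_bound:
  assumes "0 < \<delta>"
  obtains B where "\<And>x. 0 \<le> x \<Longrightarrow> \<bar>coprime_error x\<bar> \<le> \<delta> * x\<^sup>2 + B"
proof -
  have "\<exists>B. \<forall>x\<ge>0. \<bar>coprime_error x\<bar> \<le> (7 / 8) ^ j * x\<^sup>2 + B" for j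
  proof (induction j)
    case 0
    show ?case using abs_coprime_error_le by (intro exI[of _ 0]) simp
  next
    case (Suc j)
    then show ?case using coprime_error_bound_step[of "(7 / 8) ^ j"] by auto
  qed
  moreover obtain j where "(7 / 8 :: real) ^ j < \<delta>"
    using real_arch_pow_inv[OF assms, of "7 / 8"] by auto
  ultimately obtain B where B: "\<And>x. x \<ge> 0 \<Longrightarrow> \<bar>coprime_error x\<bar> \<le> (7 / 8) ^ j * x\<^sup>2 + B"
    by blast
  have "\<bar>coprime_error x\<bar> \<le> \<delta> * x\<^sup>2 + B" if "0 \<le> x" for x
    using B[OF that] mult_right_mono[of "(7 / 8) ^ j" \<delta> "x\<^sup>2"] \<open>(7 / 8) ^ j < \<delta>\<close> by auto
  then show ?thesis using that by blast
qed

subsection \<open>The mean as a dilogarithm series\<close>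

text \<open>Shifting the dilogarithm series by one power cancels the division by 1 - \<alpha>^2. The
  endpoint \<alpha> = 1 is then included: only the term \<open>j = 0\<close> survives there, with
  0^0 = 1.\<close>

lemma mu2_sums:
  assumes "0 < \<alpha>" "\<alpha> \<le> 1"
  shows "(\<lambda>j. \<alpha>\<^sup>2 * (1 - \<alpha>\<^sup>2) ^ j / real (Suc j) ^ 2) sums (mu2 \<alpha> * zeta2)"
proof (cases "\<alpha> = 1")
  case True
  have "(\<lambda>j. 1 / real (Suc j) ^ 2 * 0 ^ j) sums (1 / real (Suc 0) ^ 2)"
    by (rule powser_sums_zero)
  then show ?thesis using True zeta2_ge_1 by (simp add: mu2_def)
next
  case False
  define z where "z = 1 - \<alpha>\<^sup>2"
  have "\<alpha>\<^sup>2 < 1" "0 < \<alpha>\<^sup>2" using assms False by (auto simp: power_less_one_iff)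
  then have z: "0 < z" "z < 1" by (auto simp: z_def)
  have "summable (\<lambda>j. z ^ Suc j / real (Suc j) ^ 2)"
  proof (rule summable_comparison_test')
    show "summable (\<lambda>j. 1 / real (Suc j) ^ 2)" using zeta2_sums by (simp add: sums_iff)
    show "norm (z ^ Suc j / real (Suc j) ^ 2) \<le> 1 / real (Suc j) ^ 2" for j
      using power_le_one[of z "Suc j"] z
      by (simp add: divide_right_mono del: power_Suc of_nat_Suc)
  qed
  then have "(\<lambda>j. z ^ Suc j / real (Suc j) ^ 2) sums dilog z"
    unfolding dilog_def by (simp add: summable_sums)
  then have "(\<lambda>j. \<alpha>\<^sup>2 / z * (z ^ Suc j / real (Suc j) ^ 2)) sums (\<alpha>\<^sup>2 / z * dilog z)"
    by (rule sums_mult)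
  moreover have "\<alpha>\<^sup>2 / z * (z ^ Suc j / real (Suc j) ^ 2) = \<alpha>\<^sup>2 * z ^ j / real (Suc j) ^ 2" for j
    using z by simp
  moreover have "\<alpha>\<^sup>2 / z * dilog z = mu2 \<alpha> * zeta2"
    using False zeta2_ge_1 by (simp add: mu2_def z_def)
  ultimately show ?thesis by (simp add: z_def)
qed

text \<open>This is the term \<open>j = 0\<close> of a nonnegative series. It turns relative
  deviations into absolute ones of order n^2, uniformly for densities bounded away from 0.\<close>

lemma mu2_lower_bound:
  assumes "0 < \<alpha>" "\<alpha> \<le> 1"
  shows "\<alpha>\<^sup>2 / zeta2 \<le> mu2 \<alpha>"
proof -
  have z: "0 \<le> 1 - \<alpha>\<^sup>2" using assms by (simp add: power_le_one)
  have "(\<Sum>j<1. \<alpha>\<^sup>2 * (1 - \<alpha>\<^sup>2) ^ j / real (Suc j) ^ 2) \<le>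
      (\<Sum>j. \<alpha>\<^sup>2 * (1 - \<alpha>\<^sup>2) ^ j / real (Suc j) ^ 2)"
    using mu2_sums[OF assms] z by (intro sum_le_suminf) (auto simp: sums_iff)
  also have "\<dots> = mu2 \<alpha> * zeta2" using mu2_sums[OF assms] by (simp add: sums_iff)
  finally have "\<alpha>\<^sup>2 \<le> mu2 \<alpha> * zeta2" by simp
  then show ?thesis using zeta2_ge_1 by (simp add: field_simps)
qed

lemma coprime_pairs_div_iff:
  assumes "1 \<le> r" "1 \<le> s" "coprime r s"
  shows "(r, s) \<in> coprime_pairs (real n / real (Suc j)) \<longleftrightarrow> j < n div max r s"
proof -
  have "real r \<le> real n / real (Suc j) \<longleftrightarrow> Suc j * r \<le> n" for r
    by (subst pos_le_divide_eq)
      (simp_all flip: of_nat_mult add: mult.commute del: of_nat_Suc mult_Suc mult_Suc_right)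
  then have "(r, s) \<in> coprime_pairs (real n / real (Suc j)) \<longleftrightarrow> Suc j * max r s \<le> n"
    using assms by (simp add: coprime_pairs_def nat_mult_max_right del: of_nat_Suc mult_Suc mult_Suc_right)
  also have "\<dots> \<longleftrightarrow> Suc j \<le> n div max r s"
    using assms by (intro less_eq_div_iff_mult_less_eq[symmetric]) auto
  finally show ?thesis by (simp add: Suc_le_eq)
qed

text \<open>After the geometric expansion and the swap of sums, a pair occurs in layer
  \<open>j\<close> exactly when \<open>j < n div max r s\<close>, that is, when its entries are at
  most \<open>n / (j + 1)\<close>.\<close>

lemma sum_coprime_pairs_geometric:
  fixes z :: real
  shows "(\<Sum>(r, s)\<in>coprime_pairs (real n). 1 - z ^ (n div max r s)) =
    (\<Sum>j<n. (1 - z) * z ^ j * real (card (coprime_pairs (real n / real (Suc j)))))"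
proof -
  let ?P = "coprime_pairs (real n)"
  have sub: "coprime_pairs (real n / real (Suc j)) \<subseteq> ?P" for j
    using divide_left_mono[of 1 "real (Suc j)" "real n"] by (intro coprime_pairs_mono) simp
  have card_eq: "real (card (coprime_pairs (real n / real (Suc j)))) =
      (\<Sum>p\<in>?P. if p \<in> coprime_pairs (real n / real (Suc j)) then 1 else 0)" for j
    using sub[of j] by (simp add: sum.If_cases Int_absorb1 del: of_nat_Suc)
  have pair_eq: "1 - z ^ (n div max r s) =
      (\<Sum>j<n. (1 - z) * z ^ j * (if (r, s) \<in> coprime_pairs (real n / real (Suc j)) then 1 else 0))"
    if "(r, s) \<in> ?P" for r s
  proof -
    have rs: "1 \<le> r" "1 \<le> s" "coprime r s" using that by (auto simp: coprime_pairs_def)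
    have "(\<Sum>j<n. (1 - z) * z ^ j * (if (r, s) \<in> coprime_pairs (real n / real (Suc j)) then 1 else 0))
        = (\<Sum>j<n div max r s. (1 - z) * z ^ j)"
      using coprime_pairs_div_iff[OF rs, of n]
      by (intro sum.mono_neutral_cong_right)
        (auto simp del: of_nat_Suc intro: less_le_trans[OF _ div_le_dividend])
    also have "\<dots> = 1 - z ^ (n div max r s)"
      by (simp add: one_diff_power_eq sum_distrib_left)
    finally show ?thesis by simp
  qed
  have "(\<Sum>(r, s)\<in>?P. 1 - z ^ (n div max r s)) =
      (\<Sum>p\<in>?P. \<Sum>j<n. (1 - z) * z ^ j * (if p \<in> coprime_pairs (real n / real (Suc j)) then 1 else 0))"
    using pair_eq by (intro sum.cong) auto
  also have "\<dots> = (\<Sum>j<n. (1 - z) * z ^ j * real (card (coprime_pairs (real n / real (Suc j)))))"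
    by (subst sum.swap) (simp only: card_eq sum_distrib_left)
  finally show ?thesis .
qed

text \<open>The weights \<alpha>^2 z^j form a geometric distribution, so the sum averages the
  coprime counts at \<open>n / (j + 1)\<close>, and its error is at most the error bound at
  \<open>n\<close>. Hence the estimate is uniform in \<alpha>.\<close>

lemma sum_coprime_pairs_approx:
  assumes \<alpha>: "0 < \<alpha>" "\<alpha> \<le> 1" and "0 \<le> \<delta>"
    and B: "\<And>x. 0 \<le> x \<Longrightarrow> \<bar>coprime_error x\<bar> \<le> \<delta> * x\<^sup>2 + B"
  shows "\<bar>(\<Sum>(r, s)\<in>coprime_pairs (real n). 1 - (1 - \<alpha>\<^sup>2) ^ (n div max r s)) - mu2 \<alpha> * (real n)\<^sup>2\<bar>
    \<le> \<delta> * (real n)\<^sup>2 + B"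
proof -
  define z where "z = 1 - \<alpha>\<^sup>2"
  define w where "w j = \<alpha>\<^sup>2 * z ^ j" for j
  have z: "0 \<le> z" "z < 1" using \<alpha> by (auto simp: z_def power_le_one)
  have w: "0 \<le> w j" for j using z by (simp add: w_def)
  have "(\<lambda>j. \<alpha>\<^sup>2 * z ^ j) sums (\<alpha>\<^sup>2 * (1 / (1 - z)))"
    using z by (intro sums_mult geometric_sums) auto
  then have w_sums: "w sums 1" using \<alpha> by (simp add: w_def[abs_def] z_def)
  define S where "S = (\<Sum>(r, s)\<in>coprime_pairs (real n). 1 - z ^ (n div max r s))"
  \<comment> \<open>Layers with \<open>j \<ge> n\<close> are empty, so the finite sum is also an
    infinite series, comparable term by term with that of \<open>mu2\<close>.\<close>
  have "coprime_pairs (real n / real (Suc j)) = {}" if "n \<le> j" for j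
  proof -
    have "real n / real (Suc j) < 1" using that by simp
    then show ?thesis by (rule coprime_pairs_empty)
  qed
  then have "(\<lambda>j. w j * real (card (coprime_pairs (real n / real (Suc j))))) sums
      (\<Sum>j<n. w j * real (card (coprime_pairs (real n / real (Suc j)))))"
    by (intro sums_finite) (auto simp del: of_nat_Suc)
  then have S: "(\<lambda>j. w j * real (card (coprime_pairs (real n / real (Suc j))))) sums S"
    by (simp add: S_def sum_coprime_pairs_geometric w_def z_def)
  have "(\<lambda>j. (real n)\<^sup>2 / zeta2 * (\<alpha>\<^sup>2 * (1 - \<alpha>\<^sup>2) ^ j / real (Suc j) ^ 2)) sums
      ((real n)\<^sup>2 / zeta2 * (mu2 \<alpha> * zeta2))"
    by (intro sums_mult mu2_sums \<alpha>)
  then have "(\<lambda>j. w j * ((real n / real (Suc j))\<^sup>2 / zeta2)) sums (mu2 \<alpha> * (real n)\<^sup>2)"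
    using zeta2_ge_1 by (simp add: w_def z_def power_divide field_simps del: of_nat_Suc)
  from sums_diff[OF S this]
  have D: "(\<lambda>j. w j * coprime_error (real n / real (Suc j))) sums (S - mu2 \<alpha> * (real n)\<^sup>2)"
    by (simp add: coprime_error_def algebra_simps del: of_nat_Suc)
  have bound: "(\<lambda>j. w j * (\<delta> * (real n)\<^sup>2 + B)) sums (\<delta> * (real n)\<^sup>2 + B)"
    using sums_mult2[OF w_sums] by simp
  have le: "\<bar>w j * coprime_error (real n / real (Suc j))\<bar> \<le> w j * (\<delta> * (real n)\<^sup>2 + B)" for j
  proof -
    have "real n / real (Suc j) \<le> real n / 1" by (intro divide_left_mono) auto
    then have "\<delta> * (real n / real (Suc j))\<^sup>2 \<le> \<delta> * (real n)\<^sup>2"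
      using \<open>0 \<le> \<delta>\<close> by (intro mult_left_mono power_mono) auto
    then have "\<bar>coprime_error (real n / real (Suc j))\<bar> \<le> \<delta> * (real n)\<^sup>2 + B"
      using B[OF divide_nonneg_nonneg[OF of_nat_0_le_iff[of n] of_nat_0_le_iff[of "Suc j"]]] by linarith
    then show ?thesis using w[of j] by (simp add: abs_mult mult_left_mono)
  qed
  have "S - mu2 \<alpha> * (real n)\<^sup>2 \<le> \<delta> * (real n)\<^sup>2 + B"
    by (rule sums_le[OF _ D bound]) (use le in \<open>auto simp: abs_le_iff\<close>)
  moreover have "- (S - mu2 \<alpha> * (real n)\<^sup>2) \<le> \<delta> * (real n)\<^sup>2 + B"
    by (rule sums_le[OF _ sums_minus[OF D] bound]) (use le in \<open>auto simp: abs_le_iff\<close>)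
  ultimately show ?thesis by (simp add: S_def z_def abs_le_iff)
qed

subsection \<open>Random subsets avoiding disjoint pairs\<close>

lemma
  assumes "k \<le> n"
  shows set_random_subset: "set_pmf (random_subset n k) = {A. A \<subseteq> {1..n} \<and> card A = k}"
    and measure_random_subset: "measure_pmf.prob (random_subset n k) E =
      real (card ({A. A \<subseteq> {1..n} \<and> card A = k} \<inter> E)) / real (n choose k)"
proof -
  let ?S = "{A. A \<subseteq> {1..n} \<and> card A = k}"
  have card: "card ?S = n choose k" using n_subsets[of "{1..n}" k] by simp
  have fin: "finite ?S" by simp
  have "?S \<noteq> {}" using card assms by (metis card.empty binomial_eq_0_iff not_less)
  then show "set_pmf (random_subset n k) = ?S"
    and "measure_pmf.prob (random_subset n k) E = real (card (?S \<inter> E)) / real (n choose k)"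
    unfolding random_subset_def using fin card
    by (simp_all add: set_pmf_of_set measure_pmf_of_set)
qed

lemma card_supersets:
  assumes "finite U" "B \<subseteq> U" "card B \<le> k"
  shows "card {A. A \<subseteq> U \<and> card A = k \<and> B \<subseteq> A} = (card U - card B) choose (k - card B)"
proof -
  have finB: "finite B" using assms finite_subset by blast
  have "bij_betw (\<lambda>A. A \<union> B) {C. C \<subseteq> U - B \<and> card C = k - card B}
      {A. A \<subseteq> U \<and> card A = k \<and> B \<subseteq> A}"
  proof (rule bij_betw_byWitness[where f' = "\<lambda>A. A - B"])
    show "(\<lambda>A. A \<union> B) ` {C. C \<subseteq> U - B \<and> card C = k - card B} \<subseteq> {A. A \<subseteq> U \<and> card A = k \<and> B \<subseteq> A}"
    proof (rule image_subsetI)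
      fix C assume "C \<in> {C. C \<subseteq> U - B \<and> card C = k - card B}"
      then have C: "C \<subseteq> U - B" "card C = k - card B" by auto
      then have "finite C" using assms(1) finite_subset by blast
      then have "card (C \<union> B) = k"
        using C finB assms by (subst card_Un_disjoint) auto
      then show "C \<union> B \<in> {A. A \<subseteq> U \<and> card A = k \<and> B \<subseteq> A}" using C assms by auto
    qed
    show "(\<lambda>A. A - B) ` {A. A \<subseteq> U \<and> card A = k \<and> B \<subseteq> A} \<subseteq> {C. C \<subseteq> U - B \<and> card C = k - card B}"
      using finB by (auto simp: card_Diff_subset)
  qed auto
  then have "card {A. A \<subseteq> U \<and> card A = k \<and> B \<subseteq> A} = card {C. C \<subseteq> U - B \<and> card C = k - card B}"
    by (rule bij_betw_same_card[symmetric])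
  also have "\<dots> = card (U - B) choose (k - card B)" using assms by (intro n_subsets) auto
  also have "card (U - B) = card U - card B" using finB assms by (intro card_Diff_subset) auto
  finally show ?thesis .
qed

text \<open>For \<open>b \<le> k\<close> the ratio is the product of (k-i)/(n-i) over i < b, whose
  factors are within i/n of k/n; these differences accumulate to at most b^2/n. The value 0 for
  \<open>b > k\<close> is explicit because \<open>k - b\<close> truncates to 0 and the binomial
  coefficient would be 1.\<close>

lemma superset_ratio_approx:
  fixes n k b :: nat
  defines "q \<equiv> \<lambda>b. if b \<le> k then real ((n - b) choose (k - b)) / real (n choose k) else 0"
  assumes "k \<le> n" "b \<le> n"
  shows "\<bar>q b - (real k / real n) ^ b\<bar> \<le> real b ^ 2 / real n"
proof -
  let ?\<alpha> = "real k / real n"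
  have \<alpha>: "0 \<le> ?\<alpha>" "?\<alpha> \<le> 1" using assms by (auto simp: divide_le_eq)
  have "0 \<le> q b \<and> q b \<le> 1 \<and> \<bar>q b - ?\<alpha> ^ b\<bar> \<le> real b ^ 2 / real n"
    using \<open>b \<le> n\<close>
  proof (induction b)
    case 0
    then show ?case using \<open>k \<le> n\<close> by (simp add: q_def)
  next
    case (Suc b)
    then have IH: "0 \<le> q b" "q b \<le> 1" "\<bar>q b - ?\<alpha> ^ b\<bar> \<le> real b ^ 2 / real n" and "b < n" by auto
    show ?case
    proof (cases "b \<le> k")
      case True
      \<comment> \<open>The conditional probability that one further prescribed element is chosen.
        It vanishes at \<open>b = k\<close>, in agreement with the value 0 of \<open>q\<close>
        beyond \<open>k\<close>.\<close>
      define \<rho> where "\<rho> = (real k - real b) / (real n - real b)"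
      have \<rho>: "0 \<le> \<rho>" "\<rho> \<le> 1" using True \<open>b < n\<close> \<open>k \<le> n\<close> by (auto simp: \<rho>_def divide_le_eq)
      have q_Suc: "q (Suc b) = q b * \<rho>"
      proof (cases "b = k")
        case True
        then show ?thesis by (simp add: q_def \<rho>_def)
      next
        case False
        with True have "b < k" by simp
        have "Suc (k - Suc b) * (Suc (n - Suc b) choose Suc (k - Suc b)) =
            Suc (n - Suc b) * ((n - Suc b) choose (k - Suc b))"
          by (rule Suc_times_binomial)
        then have "(k - b) * ((n - b) choose (k - b)) = (n - b) * ((n - Suc b) choose (k - Suc b))"
          using \<open>b < k\<close> \<open>b < n\<close> by (simp only: Suc_diff_Suc)
        then have "(real k - real b) * real ((n - b) choose (k - b)) =
            (real n - real b) * real ((n - Suc b) choose (k - Suc b))"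
          using \<open>b < k\<close> \<open>b < n\<close> by (metis of_nat_mult of_nat_diff less_imp_le)
        then have "real ((n - Suc b) choose (k - Suc b)) = real ((n - b) choose (k - b)) * \<rho>"
          using \<open>b < n\<close> by (simp add: \<rho>_def eq_divide_eq mult.commute)
        then show ?thesis using \<open>b < k\<close> by (simp add: q_def)
      qed
      have "\<bar>\<rho> - ?\<alpha>\<bar> \<le> real b / real n"
      proof -
        have eq: "?\<alpha> - \<rho> = real b / real n * ((real n - real k) / (real n - real b))"
          using \<open>b < n\<close> by (simp add: \<rho>_def field_simps)
        have "0 \<le> (real n - real k) / (real n - real b)" "(real n - real k) / (real n - real b) \<le> 1"
          using True \<open>b < n\<close> \<open>k \<le> n\<close> by (auto simp: divide_le_eq)
        then have "0 \<le> ?\<alpha> - \<rho>" "?\<alpha> - \<rho> \<le> real b / real n"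
          unfolding eq by (intro mult_nonneg_nonneg mult_left_le; simp)+
        then show ?thesis by simp
      qed
      then have 1: "\<bar>q b * (\<rho> - ?\<alpha>)\<bar> \<le> 1 * (real b / real n)"
        using IH unfolding abs_mult by (intro mult_mono) auto
      have 2: "\<bar>?\<alpha> * (q b - ?\<alpha> ^ b)\<bar> \<le> 1 * (real b ^ 2 / real n)"
        using IH \<alpha> unfolding abs_mult by (intro mult_mono) auto
      have eq: "q (Suc b) - ?\<alpha> ^ Suc b = q b * (\<rho> - ?\<alpha>) + ?\<alpha> * (q b - ?\<alpha> ^ b)"
        by (simp add: q_Suc algebra_simps)
      have "\<bar>q (Suc b) - ?\<alpha> ^ Suc b\<bar> \<le> 1 * (real b / real n) + 1 * (real b ^ 2 / real n)"
        unfolding eq by (rule order_trans[OF abs_triangle_ineq add_mono[OF 1 2]])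
      also have "\<dots> = real b / real n + real b ^ 2 / real n" by simp
      also have "\<dots> \<le> real (Suc b) ^ 2 / real n"
        by (simp add: add_divide_distrib[symmetric] divide_right_mono power2_eq_square algebra_simps)
      finally show ?thesis using IH \<rho> by (simp add: q_Suc mult_le_one)
    next
      case False
      then have "q (Suc b) = 0" "q b = 0" by (auto simp: q_def)
      moreover have "?\<alpha> ^ Suc b \<le> ?\<alpha> ^ b" using \<alpha> by (intro power_decreasing) auto
      moreover have "real b ^ 2 / real n \<le> real (Suc b) ^ 2 / real n"
        by (intro divide_right_mono power_mono) auto
      ultimately show ?thesis using IH \<alpha> by auto
    qed
  qed
  then show ?thesis by simp
qed

lemma prob_superset_approx:
  assumes "k \<le> n" "B \<subseteq> {1..n}"
  shows "\<bar>measure_pmf.prob (random_subset n k) {A. B \<subseteq> A} - (real k / real n) ^ card B\<bar>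
    \<le> real (card B) ^ 2 / real n"
proof -
  have "card B \<le> n" using card_mono[OF _ assms(2)] by simp
  have "measure_pmf.prob (random_subset n k) {A. B \<subseteq> A} =
      (if card B \<le> k then real ((n - card B) choose (k - card B)) / real (n choose k) else 0)"
  proof (cases "card B \<le> k")
    case True
    have "{A. A \<subseteq> {1..n} \<and> card A = k} \<inter> {A. B \<subseteq> A} = {A. A \<subseteq> {1..n} \<and> card A = k \<and> B \<subseteq> A}" by auto
    then show ?thesis
      using card_supersets[of "{1..n}" B k] True assms by (simp add: measure_random_subset)
  next
    case False
    have "card B \<le> card A" if "A \<subseteq> {1..n}" "B \<subseteq> A" for A
      using that by (meson card_mono finite_atLeastAtMost finite_subset)
    then have "{A. A \<subseteq> {1..n} \<and> card A = k} \<inter> {A. B \<subseteq> A} = {}" using False by auto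
    then show ?thesis using False assms by (simp add: measure_random_subset)
  qed
  then show ?thesis using superset_ratio_approx[OF assms(1) \<open>card B \<le> n\<close>] by simp
qed

lemma integrable_random_subset:
  fixes f :: "nat set \<Rightarrow> real"
  assumes "k \<le> n"
  shows "integrable (random_subset n k) f"
  using assms by (intro integrable_measure_pmf_finite) (simp add: set_random_subset)

lemma expectation_of_bool:
  "measure_pmf.expectation p (\<lambda>x. of_bool (Q x)) = measure_pmf.prob p {x. Q x}"
proof -
  have "(\<lambda>x. of_bool (Q x) :: real) = indicator {x. Q x}" by (auto simp: indicator_def)
  then show ?thesis by simp
qed

definition avoids :: "'a set set \<Rightarrow> 'a set \<Rightarrow> bool" where
  "avoids F A \<longleftrightarrow> (\<forall>B\<in>F. \<not> B \<subseteq> A)"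

text \<open>Inclusion-exclusion over the subfamilies \<open>X\<close> of \<open>F\<close>. By
  disjointness the union of \<open>X\<close> has 2|X| elements, so it lies in \<open>A\<close> with
  probability nearly \<alpha>^(2|X|), and the same alternating sum of these powers is (1 -
  \<alpha>^2)^|F|. The factor 2^|F| counts the subfamilies.\<close>

lemma prob_avoids_approx:
  assumes "k \<le> n" "finite F" "disjoint F" and F: "\<And>B. B \<in> F \<Longrightarrow> B \<subseteq> {1..n} \<and> card B = 2"
  shows "\<bar>measure_pmf.prob (random_subset n k) {A. avoids F A} - (1 - (real k / real n)\<^sup>2) ^ card F\<bar>
    \<le> 2 ^ card F * (2 * real (card F))\<^sup>2 / real n"
proof -
  let ?p = "random_subset n k" and ?\<alpha> = "real k / real n"
  have "of_bool (avoids F A) = (\<Sum>X\<in>Pow F. (-1) ^ card X * of_bool (\<Union>X \<subseteq> A) :: real)" for A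
  proof -
    have prod: "(\<Prod>B\<in>X. of_bool (P B)) = (of_bool (\<forall>B\<in>X. P B) :: real)" if "finite X"
      for X and P :: "nat set \<Rightarrow> bool"
      using that by (induction X rule: finite_induct) auto
    have "of_bool (avoids F A) = (\<Prod>B\<in>F. of_bool (\<not> B \<subseteq> A) :: real)"
      using prod[OF \<open>finite F\<close>] by (simp add: avoids_def)
    also have "\<dots> = (\<Prod>B\<in>F. 1 - of_bool (B \<subseteq> A))" by (intro prod.cong) auto
    also have "\<dots> = (\<Sum>X\<in>Pow F. (-1) ^ card X * (\<Prod>B\<in>X. of_bool (B \<subseteq> A)))"
      by (simp add: prod_diff_conv_sum[OF \<open>finite F\<close>])
    also have "\<dots> = (\<Sum>X\<in>Pow F. (-1) ^ card X * of_bool (\<Union>X \<subseteq> A))"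
      using finite_subset[OF _ \<open>finite F\<close>]
      by (intro sum.cong refl) (subst prod, auto simp: Sup_le_iff)
    finally show ?thesis .
  qed
  then have "measure_pmf.prob ?p {A. avoids F A} =
      measure_pmf.expectation ?p (\<lambda>A. \<Sum>X\<in>Pow F. (-1) ^ card X * of_bool (\<Union>X \<subseteq> A))"
    by (simp flip: expectation_of_bool)
  also have "\<dots> = (\<Sum>X\<in>Pow F. (-1) ^ card X * measure_pmf.prob ?p {A. \<Union>X \<subseteq> A})"
    by (subst Bochner_Integration.integral_sum)
      (simp_all add: integrable_random_subset[OF \<open>k \<le> n\<close>] expectation_of_bool)
  finally have prob: "measure_pmf.prob ?p {A. avoids F A} =
      (\<Sum>X\<in>Pow F. (-1) ^ card X * measure_pmf.prob ?p {A. \<Union>X \<subseteq> A})" .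
  have "(1 - ?\<alpha>\<^sup>2) ^ card F = (\<Prod>B\<in>F. 1 - ?\<alpha>\<^sup>2)" by simp
  also have "\<dots> = (\<Sum>X\<in>Pow F. (-1) ^ card X * ?\<alpha> ^ (2 * card X))"
    by (subst prod_diff_conv_sum[OF \<open>finite F\<close>]) (simp add: power_mult)
  finally have "measure_pmf.prob ?p {A. avoids F A} - (1 - ?\<alpha>\<^sup>2) ^ card F =
      (\<Sum>X\<in>Pow F. (-1) ^ card X * (measure_pmf.prob ?p {A. \<Union>X \<subseteq> A} - ?\<alpha> ^ (2 * card X)))"
    by (simp add: prob sum_subtractf right_diff_distrib)
  also have "\<bar>\<dots>\<bar> \<le> (\<Sum>X\<in>Pow F. (2 * real (card F))\<^sup>2 / real n)"
  proof (intro order_trans[OF sum_abs] sum_mono)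
    fix X assume "X \<in> Pow F"
    then have X: "X \<subseteq> F" "finite X" using \<open>finite F\<close> finite_subset by auto
    have "card (\<Union>X) = (\<Sum>B\<in>X. card B)"
      using F X by (intro card_Union_disjoint pairwise_subset[OF assms(3)]) (auto dest: finite_subset)
    also have "\<dots> = 2 * card X" using F X by (subst sum.cong[OF refl, of _ _ "\<lambda>_. 2"]) auto
    finally have card: "card (\<Union>X) = 2 * card X" .
    have "\<bar>measure_pmf.prob ?p {A. \<Union>X \<subseteq> A} - ?\<alpha> ^ (2 * card X)\<bar> \<le> (2 * real (card X))\<^sup>2 / real n"
      using prob_superset_approx[of k n "\<Union>X"] F X \<open>k \<le> n\<close> unfolding card by fastforce
    also have "\<dots> \<le> (2 * real (card F))\<^sup>2 / real n"
      using card_mono[OF \<open>finite F\<close> X(1)] by (intro divide_right_mono power_mono) auto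
    finally show "\<bar>(-1) ^ card X * (measure_pmf.prob ?p {A. \<Union>X \<subseteq> A} - ?\<alpha> ^ (2 * card X))\<bar>
        \<le> (2 * real (card F))\<^sup>2 / real n" by (simp add: abs_mult)
  qed
  also have "\<dots> = 2 ^ card F * (2 * real (card F))\<^sup>2 / real n"
    using \<open>finite F\<close> by (simp add: card_Pow)
  finally show ?thesis .
qed

subsection \<open>Quotients as coprime pairs\<close>

text \<open>These are the sets whose inclusion in \<open>A\<close> witnesses that
  \<open>r / s\<close> is a quotient.\<close>

fun multiples :: "nat \<Rightarrow> nat \<times> nat \<Rightarrow> nat set set" where
  "multiples n (r, s) = (\<lambda>m. {m * r, m * s}) ` {1..n div max r s}"

lemma mem_coprime_pairs_nat:
  "(r, s) \<in> coprime_pairs (real n) \<longleftrightarrow> 1 \<le> r \<and> 1 \<le> s \<and> r \<le> n \<and> s \<le> n \<and> coprime r s"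
  by (simp add: coprime_pairs_def)

lemma multiples_iff:
  assumes "1 \<le> r" "1 \<le> s"
  shows "B \<in> multiples n (r, s) \<longleftrightarrow> (\<exists>m\<ge>1. m * r \<le> n \<and> m * s \<le> n \<and> B = {m * r, m * s})"
proof -
  have "m \<le> n div max r s \<longleftrightarrow> m * r \<le> n \<and> m * s \<le> n" for m
    using assms by (simp add: less_eq_div_iff_mult_less_eq nat_mult_max_right)
  then show ?thesis by auto
qed

text \<open>Each quotient is written in lowest terms r/s, with \<open>m\<close> the gcd of numerator
  and denominator. Uniqueness of lowest terms gives injectivity.\<close>

lemma card_quotient_set:
  assumes "A \<subseteq> {1..n}"
  shows "card (quotient_set A) = card {p \<in> coprime_pairs (real n). \<not> avoids (multiples n p) A}"
proof -
  let ?R = "{p \<in> coprime_pairs (real n). \<not> avoids (multiples n p) A}"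
  have mem: "(r, s) \<in> ?R \<longleftrightarrow> (r, s) \<in> coprime_pairs (real n) \<and> (\<exists>m\<ge>1. m * r \<in> A \<and> m * s \<in> A)" for r s
  proof -
    have "\<not> avoids (multiples n (r, s)) A \<longleftrightarrow> (\<exists>m\<ge>1. m * r \<in> A \<and> m * s \<in> A)"
      if "1 \<le> r" "1 \<le> s"
    proof -
      have le: "x \<le> n" if "x \<in> A" for x using that assms by auto
      have "\<not> avoids (multiples n (r, s)) A \<longleftrightarrow> (\<exists>m\<ge>1. m * r \<le> n \<and> m * s \<le> n \<and> {m * r, m * s} \<subseteq> A)"
        unfolding avoids_def Ball_def multiples_iff[OF that] by blast
      also have "\<dots> \<longleftrightarrow> (\<exists>m\<ge>1. m * r \<in> A \<and> m * s \<in> A)" using le by blast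
      finally show ?thesis .
    qed
    then show ?thesis by (auto simp: mem_coprime_pairs_nat simp del: multiples.simps)
  qed
  have "bij_betw (\<lambda>(r, s). of_nat r / of_nat s :: rat) ?R (quotient_set A)"
    unfolding bij_betw_def
  proof
    show "inj_on (\<lambda>(r, s). of_nat r / of_nat s :: rat) ?R"
    proof (rule inj_onI, clarify)
      fix r s r' s'
      assume "(r, s) \<in> coprime_pairs (real n)" "(r', s') \<in> coprime_pairs (real n)"
        and eq: "of_nat r / of_nat s = (of_nat r' / of_nat s' :: rat)"
      then have rs: "1 \<le> s" "1 \<le> s'" "coprime r s" "coprime r' s'"
        by (auto simp: mem_coprime_pairs_nat)
      have "of_nat (r * s') = (of_nat (r' * s) :: rat)" using eq rs by (simp add: frac_eq_eq)
      then have "r * s' = r' * s" by (simp only: of_nat_eq_iff)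
      then show "r = r' \<and> s = s'" using coprime_crossproduct_nat[of r s r' s'] rs by auto
    qed
    show "(\<lambda>(r, s). of_nat r / of_nat s :: rat) ` ?R = quotient_set A"
    proof (intro equalityI subsetI)
      fix x assume "x \<in> (\<lambda>(r, s). of_nat r / of_nat s :: rat) ` ?R"
      then obtain r s where rs: "(r, s) \<in> ?R" and x: "x = of_nat r / of_nat s" by auto
      then obtain m where m: "m \<ge> 1" "m * r \<in> A" "m * s \<in> A" using mem by blast
      then have "x = of_nat (m * r) / of_nat (m * s)" using x by simp
      then show "x \<in> quotient_set A" unfolding quotient_set_def using m by blast
    next
      fix x assume "x \<in> quotient_set A"
      then obtain a b where ab: "a \<in> A" "b \<in> A" and x: "x = of_nat a / of_nat b"
        by (auto simp: quotient_set_def)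
      then have ab': "1 \<le> a" "a \<le> n" "1 \<le> b" "b \<le> n" using assms by auto
      obtain r s where rs: "a = gcd a b * r" "b = gcd a b * s" "coprime r s"
        using gcd_coprime_exists[of a b] ab' by (auto simp: mult.commute)
      define g where "g = gcd a b"
      have g: "g \<ge> 1" using ab' by (auto simp: g_def Suc_le_eq)
      have r: "r \<ge> 1" "s \<ge> 1" using ab' rs by (auto simp: Suc_le_eq intro!: Nat.gr0I)
      have "r \<le> g * r" "s \<le> g * s" using g by auto
      then have "r \<le> n" "s \<le> n" using rs ab' by (simp_all add: g_def)
      then have "(r, s) \<in> coprime_pairs (real n)" using r rs by (simp add: mem_coprime_pairs_nat)
      moreover have "g * r \<in> A" "g * s \<in> A" unfolding g_def rs(1,2)[symmetric] by (rule ab)+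
      ultimately have "(r, s) \<in> ?R" using mem g by blast
      moreover have "x = of_nat r / of_nat s"
      proof -
        have "x = of_nat (g * r) / of_nat (g * s)" using x rs by (simp add: g_def)
        then show ?thesis using g by simp
      qed
      ultimately show "x \<in> (\<lambda>(r, s). of_nat r / of_nat s :: rat) ` ?R" by force
    qed
  qed
  then show ?thesis by (simp add: bij_betw_same_card)
qed

text \<open>
  The condition \<open>T < r, s\<close> makes the members of \<open>multiples n (r, s)\<close> disjoint, and the last one says
  \<open>n div max r s \<le> T\<close>.
\<close>
definition core_pairs :: "nat \<Rightarrow> nat \<Rightarrow> (nat \<times> nat) set" where
  "core_pairs T n = {(r, s) \<in> coprime_pairs (real n). T < r \<and> T < s \<and> n < max r s * (T + 1)}"

text \<open>If m r = m' s with 1 <= m <= T, coprimality makes \<open>s\<close> divide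
  \<open>m\<close>, against \<open>T < s\<close>; so different multipliers give disjoint sets. Also
  r = s would force both to be 1, excluded by \<open>1 \<le> T < r\<close>.\<close>

lemma core_pairs_multiples:
  assumes "1 \<le> T" and p: "(r, s) \<in> core_pairs T n"
  shows "n div max r s \<le> T" "disjoint (multiples n (r, s))"
    "card (multiples n (r, s)) = n div max r s"
    "\<And>B. B \<in> multiples n (r, s) \<Longrightarrow> B \<subseteq> {1..n} \<and> card B = 2"
proof -
  have rs: "1 \<le> r" "1 \<le> s" "coprime r s" "T < r" "T < s" "n < max r s * (T + 1)"
    using p by (auto simp: core_pairs_def mem_coprime_pairs_nat)
  show le: "n div max r s \<le> T"
    using rs less_mult_imp_div_less[of n "T + 1" "max r s"] by (simp add: mult.commute)
  have "r \<noteq> s" using rs \<open>1 \<le> T\<close> by auto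
  have cross: False if "m * r = m' * s" "1 \<le> m" "m \<le> T" for m m'
  proof -
    have "s dvd m * r" using that by simp
    then have "s dvd m" using \<open>coprime r s\<close> by (simp add: coprime_dvd_mult_left_iff coprime_commute)
    then have "s \<le> m" using that by (intro dvd_imp_le) auto
    then show False using that rs by simp
  qed
  have meet: "m = m'" if "m \<in> {1..n div max r s}" "m' \<in> {1..n div max r s}"
    "{m * r, m * s} \<inter> {m' * r, m' * s} \<noteq> {}" for m m'
    using that le rs cross[of m m'] cross[of m' m] by auto
  show "disjoint (multiples n (r, s))"
  proof (rule disjointI)
    fix B C assume "B \<in> multiples n (r, s)" "C \<in> multiples n (r, s)" "B \<noteq> C"
    then obtain m m' where *: "m \<in> {1..n div max r s}" "B = {m * r, m * s}"
        "m' \<in> {1..n div max r s}" "C = {m' * r, m' * s}"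
      unfolding multiples.simps image_iff by blast
    then show "B \<inter> C = {}" using meet[of m m'] \<open>B \<noteq> C\<close> by metis
  qed
  have "inj_on (\<lambda>m. {m * r, m * s}) {1..n div max r s}"
    by (rule inj_onI, rule meet) auto
  then show "card (multiples n (r, s)) = n div max r s" by (simp add: card_image)
  show "B \<subseteq> {1..n} \<and> card B = 2" if B: "B \<in> multiples n (r, s)" for B
  proof -
    obtain m where m: "m \<ge> 1" "m * r \<le> n" "m * s \<le> n" "B = {m * r, m * s}"
      using B unfolding multiples_iff[OF rs(1,2)] by blast
    moreover have "m * r \<noteq> m * s" using \<open>r \<noteq> s\<close> m by simp
    ultimately show ?thesis using rs by (auto simp: Suc_le_eq)
  qed
qed

lemma finite_multiples [simp]: "finite (multiples n p)"
  by (cases p) simp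

text \<open>A non-core pair has both entries at most \<open>n div (T + 1)\<close> or one entry at
  most \<open>T\<close>. Relative to n^2, the first kind is rare for large \<open>T\<close>, the
  second for fixed \<open>T\<close> as n grows.\<close>

lemma card_non_core_le:
  "real (card (coprime_pairs (real n) - core_pairs T n)) \<le> (real n / real (T + 1))\<^sup>2 + 2 * real T * real n"
proof -
  let ?m = "n div (T + 1)"
  have "coprime_pairs (real n) - core_pairs T n \<subseteq>
      {1..?m} \<times> {1..?m} \<union> ({1..T} \<times> {1..n} \<union> {1..n} \<times> {1..T})"
  proof
    fix p assume p: "p \<in> coprime_pairs (real n) - core_pairs T n"
    obtain r s where [simp]: "p = (r, s)" by (cases p)
    have "max r s * (T + 1) \<le> n \<Longrightarrow> max r s \<le> ?m"
      by (subst less_eq_div_iff_mult_less_eq) auto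
    with p show "p \<in> {1..?m} \<times> {1..?m} \<union> ({1..T} \<times> {1..n} \<union> {1..n} \<times> {1..T})"
      by (auto simp: core_pairs_def mem_coprime_pairs_nat)
  qed
  then have "card (coprime_pairs (real n) - core_pairs T n) \<le>
      card ({1..?m} \<times> {1..?m} \<union> ({1..T} \<times> {1..n} \<union> {1..n} \<times> {1..T}))"
    by (intro card_mono) auto
  also have "\<dots> \<le> ?m * ?m + (T * n + n * T)"
    by (intro order_trans[OF card_Un_le] add_mono) (simp_all add: card_cartesian_product)
  finally have "real (card (coprime_pairs (real n) - core_pairs T n)) \<le> real (?m * ?m + (T * n + n * T))"
    by (simp only: of_nat_le_iff)
  also have "\<dots> = real ?m * real ?m + 2 * real T * real n" by simp
  also have "real ?m * real ?m \<le> (real n / real (T + 1)) * (real n / real (T + 1))"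
    by (intro mult_mono of_nat_div_le_of_nat) auto
  finally show ?thesis by (simp add: power2_eq_square)
qed

text \<open>The possible obstructions to independence of two core pairs: a set from one family meets
  a set from the other. Multipliers up to \<open>T\<close> suffice for core pairs.\<close>

definition linked_pairs :: "nat \<Rightarrow> nat \<Rightarrow> ((nat \<times> nat) \<times> (nat \<times> nat)) set" where
  "linked_pairs T n = {(p, q). p \<in> {1..n} \<times> {1..n} \<and> q \<in> {1..n} \<times> {1..n} \<and>
     (\<exists>m\<in>{1..T}. \<exists>m'\<in>{1..T}. {m * fst p, m * snd p} \<inter> {m' * fst q, m' * snd q} \<noteq> {})}"

lemma finite_linked_pairs: "finite (linked_pairs T n)"
  by (rule finite_subset[of _ "({1..n} \<times> {1..n}) \<times> ({1..n} \<times> {1..n})"]) (auto simp: linked_pairs_def)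

text \<open>There are 4 T^2 choices of the multipliers and of the two coinciding coordinates. Each
  gives a linear equation fixing one of four coordinates, which leaves at most n^3 solutions,
  negligible against n^4.\<close>

lemma card_linked_pairs_le: "card (linked_pairs T n) \<le> 4 * T\<^sup>2 * n ^ 3"
proof -
  define N where "N = {1..n} \<times> {1..n}"
  define L where "L = (\<lambda>(m, m', b, b').
    {(p, q). p \<in> N \<and> q \<in> N \<and>
       m * (if b then fst p else snd p) = m' * (if b' then fst q else snd q)})"
  define I where "I = {1..T} \<times> {1..T} \<times> (UNIV :: bool set) \<times> (UNIV :: bool set)"
  have "linked_pairs T n \<subseteq> (\<Union>i\<in>I. L i)"
  proof
    fix x assume "x \<in> linked_pairs T n"
    then obtain p q m m' where x: "x = (p, q)" "p \<in> N" "q \<in> N" "m \<in> {1..T}" "m' \<in> {1..T}"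
      "{m * fst p, m * snd p} \<inter> {m' * fst q, m' * snd q} \<noteq> {}"
      by (auto simp: linked_pairs_def N_def)
    have "\<exists>b b'. m * (if b then fst p else snd p) = m' * (if b' then fst q else snd q)"
      using x(6) unfolding ex_bool_eq by auto
    then obtain b b' where "m * (if b then fst p else snd p) = m' * (if b' then fst q else snd q)"
      by blast
    then have "x \<in> L (m, m', b, b')" using x by (auto simp: L_def)
    then show "x \<in> (\<Union>i\<in>I. L i)"
      using x by (intro UN_I[of "(m, m', b, b')"]) (auto simp: I_def)
  qed
  moreover have fin: "finite (L i)" for i
    by (rule finite_subset[of _ "N \<times> N"]) (auto simp: L_def N_def split: prod.splits)
  ultimately have "card (linked_pairs T n) \<le> card (\<Union>i\<in>I. L i)"
    by (intro card_mono finite_UN_I) (auto simp: I_def)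
  also have "\<dots> \<le> (\<Sum>i\<in>I. card (L i))" by (rule card_UN_le) (simp add: I_def)
  also have "\<dots> \<le> (\<Sum>i\<in>I. n ^ 3)"
  proof (rule sum_mono)
    fix i assume "i \<in> I"
    then obtain m m' b b' where i: "i = (m, m', b, b')" "m' \<ge> 1" by (auto simp: I_def)
    \<comment> \<open>the linked coordinate of \<open>q\<close> is determined by \<open>p\<close>, so only the other one is kept\<close>
    let ?f = "\<lambda>(p :: nat \<times> nat, q). (p, if b' then snd q else fst q)"
    have "inj_on ?f (L i)" using i by (intro inj_onI) (auto simp: L_def split: if_splits)
    moreover have "?f ` L i \<subseteq> N \<times> {1..n}" by (auto simp: L_def N_def i)
    ultimately have "card (L i) \<le> card (N \<times> {1..n})"
      by (intro card_inj_on_le) (auto simp: N_def)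
    then show "card (L i) \<le> n ^ 3" by (simp add: N_def card_cartesian_product power3_eq_cube)
  qed
  also have "\<dots> = 4 * T\<^sup>2 * n ^ 3"
    by (simp add: I_def card_cartesian_product card_UNIV_bool power2_eq_square)
  finally show ?thesis .
qed

subsection \<open>Concentration\<close>

text \<open>The square is expanded around the approximate means \<open>z i\<close>. For
  \<open>i\<close>, \<open>j\<close> in \<open>C\<close> with (i, j) outside \<open>L\<close>, the
  joint probability and the two single ones contribute an error of at most \<open>d\<close> each;
  any other product is at most 1 and is merely counted.\<close>

lemma second_moment_le:
  fixes X :: "'i \<Rightarrow> 'a \<Rightarrow> bool" and z :: "'i \<Rightarrow> real"
  assumes P: "finite P" and fin: "finite (set_pmf p)" and "0 \<le> d"
    and z: "\<And>i. i \<in> P \<Longrightarrow> 0 \<le> z i \<and> z i \<le> 1"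
    and single: "\<And>i. i \<in> C \<Longrightarrow> \<bar>measure_pmf.prob p {x. X i x} - z i\<bar> \<le> d"
    and joint: "\<And>i j. i \<in> C \<Longrightarrow> j \<in> C \<Longrightarrow> (i, j) \<notin> L \<Longrightarrow>
      \<bar>measure_pmf.prob p {x. X i x \<and> X j x} - z i * z j\<bar> \<le> d"
    and "C \<subseteq> P" and "finite L"
  shows "measure_pmf.expectation p (\<lambda>x. (\<Sum>i\<in>P. of_bool (X i x) - z i)\<^sup>2) \<le>
    3 * d * real (card P) ^ 2 + (2 * real (card P) * real (card (P - C)) + real (card L))"
proof -
  let ?Z = "\<lambda>i x. of_bool (X i x) - z i :: real"
  define E where "E i j = measure_pmf.expectation p (\<lambda>x. ?Z i x * ?Z j x)" for i j
  have int: "integrable p f" for f :: "'a \<Rightarrow> real" using fin by (rule integrable_measure_pmf_finite)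
  have bad: "E i j \<le> 1" if "i \<in> P" "j \<in> P" for i j
  proof -
    have "\<bar>?Z i x * ?Z j x\<bar> \<le> 1 * 1" for x
      unfolding abs_mult using z[OF that(1)] z[OF that(2)] by (intro mult_mono) (auto simp: abs_le_iff)
    then have "?Z i x * ?Z j x \<le> 1" for x
      using abs_le_D1 by (metis mult_1)
    then have "E i j \<le> measure_pmf.expectation p (\<lambda>x. 1)"
      unfolding E_def by (intro integral_mono int) auto
    then show ?thesis by simp
  qed
  have good: "E i j \<le> 3 * d" if "i \<in> C" "j \<in> C" "(i, j) \<notin> L" for i j
  proof -
    let ?pi = "measure_pmf.prob p {x. X i x}" and ?pj = "measure_pmf.prob p {x. X j x}"
      and ?pij = "measure_pmf.prob p {x. X i x \<and> X j x}"
    have zz: "0 \<le> z i" "z i \<le> 1" "0 \<le> z j" "z j \<le> 1" using that z \<open>C \<subseteq> P\<close> by auto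
    have "?Z i x * ?Z j x =
        of_bool (X i x \<and> X j x) - z j * of_bool (X i x) - z i * of_bool (X j x) + z i * z j" for x
      by (simp add: algebra_simps of_bool_conj)
    then have "E i j = ?pij - z j * ?pi - z i * ?pj + z i * z j"
      unfolding E_def by (simp add: int expectation_of_bool)
    also have "\<dots> = (?pij - z i * z j) + z j * (z i - ?pi) + z i * (z j - ?pj)"
      by (simp add: algebra_simps)
    also have "\<dots> \<le> d + 1 * d + 1 * d"
    proof (intro add_mono)
      show "?pij - z i * z j \<le> d" using joint[OF that] by simp
      have "z j * (z i - ?pi) \<le> z j * d"
        using single[OF that(1)] zz by (intro mult_left_mono) auto
      then show "z j * (z i - ?pi) \<le> 1 * d"
        using zz \<open>0 \<le> d\<close> mult_right_mono[of "z j" 1 d] by simp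
      have "z i * (z j - ?pj) \<le> z i * d"
        using single[OF that(2)] zz by (intro mult_left_mono) auto
      then show "z i * (z j - ?pj) \<le> 1 * d"
        using zz \<open>0 \<le> d\<close> mult_right_mono[of "z i" 1 d] by simp
    qed
    finally show ?thesis by simp
  qed
  define Bad where "Bad = (P \<times> (P - C) \<union> (P - C) \<times> P) \<union> L"
  have finBad: "finite Bad" using P \<open>finite L\<close> by (simp add: Bad_def)
  have "measure_pmf.expectation p (\<lambda>x. (\<Sum>i\<in>P. ?Z i x)\<^sup>2) =
      measure_pmf.expectation p (\<lambda>x. \<Sum>(i, j)\<in>P \<times> P. ?Z i x * ?Z j x)"
    by (simp add: power2_eq_square sum_product sum.cartesian_product)
  also have "\<dots> = (\<Sum>(i, j)\<in>P \<times> P. E i j)"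
    unfolding E_def by (subst Bochner_Integration.integral_sum) (auto intro!: int sum.cong)
  also have "\<dots> \<le> (\<Sum>ij\<in>P \<times> P. 3 * d + of_bool (ij \<in> Bad))"
    using bad good \<open>0 \<le> d\<close> by (intro sum_mono) (fastforce simp: Bad_def)
  also have "\<dots> = 3 * d * real (card P) ^ 2 + real (card (P \<times> P \<inter> Bad))"
    using P by (simp add: sum.distrib card_cartesian_product power2_eq_square of_bool_def sum.If_cases
        Collect_mem_eq)
  also have "card (P \<times> P \<inter> Bad) \<le> card Bad" using finBad by (intro card_mono) auto
  also have "card Bad \<le> (card P * card (P - C) + card (P - C) * card P) + card L"
    unfolding Bad_def
    by (intro order_trans[OF card_Un_le] add_mono) (auto simp: card_cartesian_product)
  finally show ?thesis by (simp add: algebra_simps)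
qed

text \<open>The events are avoidance of \<open>multiples n p\<close>, with the core pairs as good
  indices and the linked pairs as exceptions. For fixed \<open>T\<close>, all terms but the first
  are of lower order than n^4.\<close>

lemma quotient_second_moment:
  fixes T n k :: nat
  assumes "1 \<le> T" "k \<le> n" "1 \<le> n"
  defines "z \<equiv> 1 - (real k / real n)\<^sup>2"
  defines "S \<equiv> \<Sum>(r, s)\<in>coprime_pairs (real n). 1 - z ^ (n div max r s)"
  shows "measure_pmf.expectation (random_subset n k) (\<lambda>A. (real (card (quotient_set A)) - S)\<^sup>2) \<le>
    (2 / real (T + 1) ^ 2 + (48 * 4 ^ T * real T ^ 2 + 4 * real T + 4 * real T ^ 2) / real n) * real n ^ 4"
proof -
  let ?P = "coprime_pairs (real n)" and ?p = "random_subset n k"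
  \<comment> \<open>For a core pair the exponent is the size of its family, so \<open>w\<close>
    approximates the avoidance probability; for other pairs only the range [0, 1] matters.\<close>
  define w where "w = (\<lambda>(r, s). z ^ (n div max r s))"
  \<comment> \<open>The error of \<open>prob_avoids_approx\<close> for 2T sets, enough for the union
    of two core families. It enters the second moment three times, whence 48 = 3 * 16.\<close>
  define d where "d = 4 ^ T * (4 * real T)\<^sup>2 / real n"
  have z: "0 \<le> z" "z \<le> 1" using assms by (auto simp: z_def power_le_one divide_le_eq)
  have approx: "\<bar>measure_pmf.prob ?p {A. avoids F A} - z ^ card F\<bar> \<le> d"
    if "finite F" "disjoint F" "\<And>B. B \<in> F \<Longrightarrow> B \<subseteq> {1..n} \<and> card B = 2" "card F \<le> 2 * T" for F
  proof -
    have "\<bar>measure_pmf.prob ?p {A. avoids F A} - z ^ card F\<bar> \<le> 2 ^ card F * (2 * real (card F))\<^sup>2 / real n"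
      unfolding z_def using that by (intro prob_avoids_approx \<open>k \<le> n\<close>)
    also have "\<dots> \<le> 2 ^ (2 * T) * (2 * real (2 * T))\<^sup>2 / real n"
      using that(4) by (intro divide_right_mono mult_mono power_mono power_increasing) auto
    also have "\<dots> = d" by (simp add: d_def power_mult)
    finally show ?thesis .
  qed
  have core: "finite (multiples n p) \<and> disjoint (multiples n p) \<and> card (multiples n p) \<le> T \<and>
      z ^ card (multiples n p) = w p \<and> (\<forall>B\<in>multiples n p. B \<subseteq> {1..n} \<and> card B = 2)"
    if "p \<in> core_pairs T n" for p
    using core_pairs_multiples[OF \<open>1 \<le> T\<close>, of "fst p" "snd p" n] that
    by (cases p) (simp add: w_def del: multiples.simps)
  have "measure_pmf.expectation ?p (\<lambda>A. (\<Sum>p\<in>?P. of_bool (avoids (multiples n p) A) - w p)\<^sup>2) \<le>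
    3 * d * real (card ?P) ^ 2 +
      (2 * real (card ?P) * real (card (?P - core_pairs T n)) + real (card (linked_pairs T n)))"
  proof (rule second_moment_le)
    show "\<bar>measure_pmf.prob ?p {A. avoids (multiples n p) A} - w p\<bar> \<le> d" if "p \<in> core_pairs T n" for p
      using approx[of "multiples n p"] core[OF that] by auto
    fix p q assume pq: "p \<in> core_pairs T n" "q \<in> core_pairs T n" "(p, q) \<notin> linked_pairs T n"
    let ?F = "multiples n p" and ?G = "multiples n q"
    have cross: "B \<inter> C = {}" if BC: "B \<in> ?F" "C \<in> ?G" for B C
    proof -
      obtain r s r' s' where p: "p = (r, s)" and q: "q = (r', s')" by (cases p, cases q)
      obtain m where m: "m \<in> {1..n div max r s}" "B = {m * r, m * s}"
        using BC(1) unfolding p multiples.simps image_iff by blast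
      obtain m' where m': "m' \<in> {1..n div max r' s'}" "C = {m' * r', m' * s'}"
        using BC(2) unfolding q multiples.simps image_iff by blast
      have "n div max r s \<le> T" "n div max r' s' \<le> T"
        using core_pairs_multiples(1)[OF \<open>1 \<le> T\<close>] pq p q by blast+
      then have "m \<in> {1..T}" "m' \<in> {1..T}" using m m' by auto
      moreover have "p \<in> {1..n} \<times> {1..n}" "q \<in> {1..n} \<times> {1..n}"
        using pq by (auto simp: core_pairs_def mem_coprime_pairs_nat)
      ultimately have "{m * fst p, m * snd p} \<inter> {m' * fst q, m' * snd q} = {}"
        using pq(3) unfolding linked_pairs_def by blast
      then show ?thesis unfolding m(2) m'(2) p q fst_conv snd_conv .
    qed
    \<comment> \<open>A common member would meet itself in the empty set, impossible for a
      two-element set. The sizes therefore add, and the power of \<open>z\<close> factors as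
      \<open>w p * w q\<close>.\<close>
    have disj: "?F \<inter> ?G = {}"
    proof -
      have "B \<noteq> {}" if "B \<in> ?F" for B using core[OF pq(1)] that by fastforce
      then show ?thesis using cross by blast
    qed
    have card: "card (?F \<union> ?G) = card ?F + card ?G" using disj by (simp add: card_Un_disjoint)
    have "disjoint (?F \<union> ?G)"
      using core[OF pq(1)] core[OF pq(2)] cross
      by (intro disjoint_union) auto
    then have "\<bar>measure_pmf.prob ?p {A. avoids (?F \<union> ?G) A} - z ^ card (?F \<union> ?G)\<bar> \<le> d"
      using core[OF pq(1)] core[OF pq(2)] by (intro approx) (auto simp: card)
    moreover have "avoids (?F \<union> ?G) A \<longleftrightarrow> avoids ?F A \<and> avoids ?G A" for A
      by (auto simp: avoids_def)
    ultimately show "\<bar>measure_pmf.prob ?p {A. avoids ?F A \<and> avoids ?G A} - w p * w q\<bar> \<le> d"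
      using core[OF pq(1)] core[OF pq(2)] by (simp add: card power_add)
  next
    show "0 \<le> w p \<and> w p \<le> 1" for p using z by (auto simp: w_def power_le_one split: prod.splits)
  qed (auto simp: set_random_subset[OF \<open>k \<le> n\<close>] d_def core_pairs_def finite_linked_pairs)
  \<comment> \<open>Passing from avoided pairs to their complement only flips the sign of the
    deviation.\<close>
  also have "(\<lambda>A. (\<Sum>p\<in>?P. of_bool (avoids (multiples n p) A) - w p)\<^sup>2) =
      (\<lambda>A. (real (card {p\<in>?P. \<not> avoids (multiples n p) A}) - S)\<^sup>2)"
  proof
    fix A
    have "S = (\<Sum>p\<in>?P. 1 - w p)" unfolding S_def w_def by (intro sum.cong) auto
    moreover have "real (card {p\<in>?P. \<not> avoids (multiples n p) A}) =
        (\<Sum>p\<in>?P. 1 - of_bool (avoids (multiples n p) A))"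
    proof -
      have "(\<Sum>p\<in>?P. 1 - of_bool (avoids (multiples n p) A)) =
          (\<Sum>p\<in>?P. if \<not> avoids (multiples n p) A then 1 else 0 :: real)"
        by (intro sum.cong) auto
      then show ?thesis by (simp add: sum.If_cases Int_def)
    qed
    ultimately have "real (card {p\<in>?P. \<not> avoids (multiples n p) A}) - S =
        - (\<Sum>p\<in>?P. of_bool (avoids (multiples n p) A) - w p)"
      by (simp add: sum_subtractf)
    then show "(\<Sum>p\<in>?P. of_bool (avoids (multiples n p) A) - w p)\<^sup>2 =
        (real (card {p\<in>?P. \<not> avoids (multiples n p) A}) - S)\<^sup>2" by simp
  qed
  \<comment> \<open>Counting quotients by pairs requires \<open>A \<subseteq> {1..n}\<close>, so the
    integrands agree only on the support.\<close>
  also have "measure_pmf.expectation ?p \<dots> =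
      measure_pmf.expectation ?p (\<lambda>A. (real (card (quotient_set A)) - S)\<^sup>2)"
    using card_quotient_set[of _ n]
    by (intro integral_cong_AE) (auto simp: AE_measure_pmf_iff set_random_subset[OF \<open>k \<le> n\<close>])
  also have "3 * d * real (card ?P) ^ 2 +
      (2 * real (card ?P) * real (card (?P - core_pairs T n)) + real (card (linked_pairs T n))) \<le>
      3 * d * (real n ^ 2) ^ 2 +
      (2 * real n ^ 2 * ((real n / real (T + 1))\<^sup>2 + 2 * real T * real n) + 4 * real T ^ 2 * real n ^ 3)"
  proof -
    have P: "real (card ?P) \<le> real n ^ 2" by (rule card_coprime_pairs_le) simp
    have "real (card (linked_pairs T n)) \<le> real (4 * T\<^sup>2 * n ^ 3)"
      using card_linked_pairs_le by (simp only: of_nat_le_iff)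
    then show ?thesis using P card_non_core_le[of n T]
      by (intro add_mono mult_mono power_mono) (auto simp: d_def)
  qed
  also have "\<dots> = (2 / real (T + 1) ^ 2 +
      (48 * 4 ^ T * real T ^ 2 + 4 * real T + 4 * real T ^ 2) / real n) * real n ^ 4"
    using \<open>1 \<le> n\<close>
    by (simp add: d_def divide_simps del: of_nat_Suc of_nat_add)
      (simp add: algebra_simps power2_eq_square eval_nat_numeral)
  finally show ?thesis .
qed

text \<open>Chebyshev's argument around \<open>S\<close> instead of the exact mean. As
  \<open>c\<^sup>2 / zeta2\<close> bounds \<open>mu2 \<alpha>\<close> from below, a relative
  deviation above \<epsilon> is an absolute one above 2 \<tau> n^2: half of it is reserved for the
  distance of \<open>S\<close> from the claimed size, the other half is left to chance.\<close>

lemma prob_card_quotient_set_deviation: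
  fixes T n k :: nat and c B \<epsilon> :: real
  defines "\<alpha> \<equiv> real k / real n"
  defines "\<tau> \<equiv> \<epsilon> * (c\<^sup>2 / zeta2) / 2"
  assumes "1 \<le> T" "k \<le> n" "1 \<le> n" "0 < c" "c \<le> \<alpha>" "0 < \<epsilon>"
    and B: "\<And>x. 0 \<le> x \<Longrightarrow> \<bar>coprime_error x\<bar> \<le> \<tau> / 2 * x\<^sup>2 + B"
    and n: "B \<le> \<tau> / 2 * (real n)\<^sup>2"
  shows "measure_pmf.prob (random_subset n k)
      {A. \<bar>real (card (quotient_set A)) / (mu2 \<alpha> * (real n)\<^sup>2) - 1\<bar> > \<epsilon>} \<le>
    (2 / real (T + 1) ^ 2 + (48 * 4 ^ T * real T ^ 2 + 4 * real T + 4 * real T ^ 2) / real n) / \<tau>\<^sup>2"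
    (is "measure_pmf.prob ?p ?E \<le> ?K / \<tau>\<^sup>2")
proof -
  define S where "S = (\<Sum>(r, s)\<in>coprime_pairs (real n). 1 - (1 - \<alpha>\<^sup>2) ^ (n div max r s))"
  have \<alpha>: "0 < \<alpha>" "\<alpha> \<le> 1" using assms by (auto simp: \<alpha>_def)
  have \<tau>: "0 < \<tau>" using \<open>0 < \<epsilon>\<close> \<open>0 < c\<close> zeta2_ge_1 by (simp add: \<tau>_def)
  have "c\<^sup>2 / zeta2 \<le> \<alpha>\<^sup>2 / zeta2"
    using \<open>0 < c\<close> \<open>c \<le> \<alpha>\<close> zeta2_ge_1 by (intro divide_right_mono power_mono) auto
  then have mu2: "c\<^sup>2 / zeta2 \<le> mu2 \<alpha>" using mu2_lower_bound[OF \<alpha>] by linarith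
  have mu2_pos: "0 < mu2 \<alpha>"
    using mu2 \<open>0 < c\<close> zeta2_ge_1 by (smt (verit) divide_pos_pos zero_less_power)
  have S: "\<bar>S - mu2 \<alpha> * (real n)\<^sup>2\<bar> \<le> \<tau> * (real n)\<^sup>2"
    using sum_coprime_pairs_approx[OF \<alpha> _ B, of n] n \<tau> by (simp add: S_def)
  have "?E \<subseteq> {A. (\<tau> * (real n)\<^sup>2)\<^sup>2 \<le> (real (card (quotient_set A)) - S)\<^sup>2}"
  proof
    fix A assume "A \<in> ?E"
    define q where "q = real (card (quotient_set A))"
    define m where "m = mu2 \<alpha> * (real n)\<^sup>2"
    have m: "0 < m" using mu2_pos \<open>1 \<le> n\<close> by (simp add: m_def)
    have "2 * (\<tau> * (real n)\<^sup>2) = \<epsilon> * (c\<^sup>2 / zeta2 * (real n)\<^sup>2)" by (simp add: \<tau>_def)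
    also have "\<dots> \<le> \<epsilon> * m"
      using mu2 \<open>0 < \<epsilon>\<close> unfolding m_def by (intro mult_left_mono mult_right_mono) auto
    also have "\<dots> < \<bar>q / m - 1\<bar> * m"
      using \<open>A \<in> ?E\<close> m unfolding q_def m_def by (intro mult_strict_right_mono) auto
    also have "\<dots> = \<bar>(q / m - 1) * m\<bar>" using m by (simp only: abs_mult abs_of_pos)
    also have "(q / m - 1) * m = q - m" using m by (simp add: field_simps)
    finally have "\<tau> * (real n)\<^sup>2 \<le> \<bar>q - S\<bar>" using S unfolding m_def by linarith
    moreover have "0 \<le> \<tau> * (real n)\<^sup>2" using \<tau> by simp
    ultimately have "(\<tau> * (real n)\<^sup>2)\<^sup>2 \<le> (q - S)\<^sup>2" by (metis power2_abs power_mono)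
    then show "A \<in> {A. (\<tau> * (real n)\<^sup>2)\<^sup>2 \<le> (real (card (quotient_set A)) - S)\<^sup>2}"
      by (simp add: q_def)
  qed
  then have "measure_pmf.prob ?p ?E \<le>
      measure_pmf.prob ?p {A \<in> space ?p. (\<tau> * (real n)\<^sup>2)\<^sup>2 \<le> (real (card (quotient_set A)) - S)\<^sup>2}"
    by (intro measure_pmf.finite_measure_mono) auto
  also have "\<dots> \<le> measure_pmf.expectation ?p (\<lambda>A. (real (card (quotient_set A)) - S)\<^sup>2) / (\<tau> * (real n)\<^sup>2)\<^sup>2"
    using \<tau> \<open>1 \<le> n\<close>
    by (intro integral_Markov_inequality_measure[of _ _ "{}"] integrable_random_subset \<open>k \<le> n\<close>) auto
  also have "\<dots> \<le> ?K * real n ^ 4 / (\<tau> * (real n)\<^sup>2)\<^sup>2"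
    using quotient_second_moment[OF \<open>1 \<le> T\<close> \<open>k \<le> n\<close> \<open>1 \<le> n\<close>]
    by (intro divide_right_mono) (simp_all only: S_def \<alpha>_def zero_le_power2)
  also have "\<dots> = ?K / \<tau>\<^sup>2" using \<open>1 \<le> n\<close> \<tau> by (simp add: power_mult_distrib)
  finally show ?thesis .
qed

theorem theorem1p2:
  fixes k :: "nat \<Rightarrow> nat" and c :: real
  assumes "c > 0"
    and "\<And>n. n \<ge> 1 \<Longrightarrow> c * real n \<le> real (k n) \<and> k n \<le> n"
  shows "\<forall>\<epsilon>>0.
    (\<lambda>n. measure_pmf.prob (random_subset n (k n))
       {A. \<bar>real (card (quotient_set A)) / (mu2 (real (k n) / real n) * (real n)\<^sup>2) - 1\<bar> > \<epsilon>})
    \<longlonglongrightarrow> 0"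
proof (intro allI impI order_tendstoI)
  fix \<epsilon> \<eta> :: real assume "0 < \<epsilon>" "0 < \<eta>"
  define \<tau> where "\<tau> = \<epsilon> * (c\<^sup>2 / zeta2) / 2"
  have \<tau>: "0 < \<tau>" using \<open>0 < \<epsilon>\<close> \<open>0 < c\<close> zeta2_ge_1 by (simp add: \<tau>_def)
  then obtain B where B: "\<And>x. 0 \<le> x \<Longrightarrow> \<bar>coprime_error x\<bar> \<le> \<tau> / 2 * x\<^sup>2 + B"
    using coprime_error_bound[of "\<tau> / 2"] by auto
  \<comment> \<open>\<open>T\<close> is fixed before \<open>n\<close> tends to infinity: it makes
    the share of non-core pairs small, while \<open>K\<close> grows exponentially in
    \<open>T\<close> and is then removed by 1/n.\<close>
  have "(\<lambda>T. 2 / real (T + 1) ^ 2) \<longlonglongrightarrow> 0" by real_asymp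
  then have "eventually (\<lambda>T. 2 / real (T + 1) ^ 2 < \<eta> * \<tau>\<^sup>2 \<and> 1 \<le> T) sequentially"
    using \<open>0 < \<eta>\<close> \<tau> by (intro eventually_conj order_tendstoD(2) eventually_ge_at_top) auto
  then obtain T where T: "2 / real (T + 1) ^ 2 < \<eta> * \<tau>\<^sup>2" "1 \<le> T"
    using eventually_happens trivial_limit_sequentially by blast
  define K where "K = 48 * 4 ^ T * real T ^ 2 + 4 * real T + 4 * real T ^ 2"
  have "(\<lambda>n. 2 / real (T + 1) ^ 2 + K / real n) \<longlonglongrightarrow> 2 / real (T + 1) ^ 2 + 0"
    by (intro tendsto_intros lim_const_over_n)
  then have "eventually (\<lambda>n. 2 / real (T + 1) ^ 2 + K / real n < \<eta> * \<tau>\<^sup>2) sequentially"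
    using T(1) by (intro order_tendstoD(2)) auto
  moreover have "eventually (\<lambda>n. B \<le> \<tau> / 2 * (real n)\<^sup>2) sequentially"
    using \<tau> by real_asymp
  moreover have "eventually (\<lambda>n. 1 \<le> n) sequentially" by (rule eventually_ge_at_top)
  ultimately show "eventually (\<lambda>n. measure_pmf.prob (random_subset n (k n))
       {A. \<bar>real (card (quotient_set A)) / (mu2 (real (k n) / real n) * (real n)\<^sup>2) - 1\<bar> > \<epsilon>} < \<eta>) sequentially"
  proof eventually_elim
    case (elim n)
    have "c \<le> real (k n) / real n" "k n \<le> n" using assms(2)[of n] elim by (auto simp: field_simps)
    then have "measure_pmf.prob (random_subset n (k n))
       {A. \<bar>real (card (quotient_set A)) / (mu2 (real (k n) / real n) * (real n)\<^sup>2) - 1\<bar> > \<epsilon>} \<le>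
       (2 / real (T + 1) ^ 2 + K / real n) / \<tau>\<^sup>2"
      using elim T(2) B \<open>0 < \<epsilon>\<close> \<open>0 < c\<close> unfolding K_def \<tau>_def
      by (intro prob_card_quotient_set_deviation) auto
    also have "\<dots> < \<eta>" using elim \<tau> by (simp add: divide_less_eq)
    finally show ?case .
  qed
\<comment> \<open>The remaining half of convergence holds because probabilities exceed every
  negative number.\<close>
qed (auto intro!: always_eventually elim: order.strict_trans2)

end
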